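(* Let $\frac13<\gamma<1$, let $T>0$, and let $\Omega\subset\mathbb{R}^2$ be a smooth bounded domain. Let $u_0:\mathbb{R}^2\to\mathbb{R}$ be Lipschitz continuous with $u_0<0$ in $\Omega$, $u_0\ge 0$ in $\mathbb{R}^2\setminus\bar\Omega$ and $|u_0|\le 1$. Let $\alpha_1,\alpha_2$ be fixed real numbers with $$\frac{1-\gamma}{2\gamma}<\alpha_1<\min\left(1,\frac{1-\gamma}{\gamma}\right),\qquad 0<\alpha_2<\min\left(\alpha_1\frac{2\gamma}{1-\gamma}-1,\ \frac13\right),$$ and for $0<\epsilon<1$ let $u^\epsilon$ be the value functions defined in the context with these data. Then the upper half-relaxed limit $$\bar u(X)=\limsup_{Y\to X,\ \epsilon\to0}u^\epsilon(Y)$$ is a viscosity subsolution of $$u_t-|\nabla u|\,\varphi(\operatorname{curv}(u))=0 .$$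
   Context: Value functions. Set $f(s)=c_\gamma s^{\frac{2\gamma}{\gamma-1}}$ for $s>0$, where $c_\gamma=(1-\gamma)(2\gamma)^{\frac{\gamma}{1-\gamma}}$, and $I_\epsilon=[\epsilon^{\alpha_1},\epsilon^{-\alpha_2}]$. For $v\in\mathbb{R}^2$, $v^\perp$ denotes $v$ rotated by $\pi/2$. The function $u^\epsilon$ is defined on $\mathbb{R}^2\times\{T-k\epsilon^2:\ k=0,1,2,\dots,\ T-k\epsilon^2\ge0\}$ backwards in time by $u^\epsilon(\cdot,T)=u_0$ and $$u^\epsilon(x,t)=\min_{\|v\|=1,\ s\in I_\epsilon}\ \max_{b,\beta\in\{-1,1\}}u^\epsilon\big(x+b\,\epsilon s\,v+\beta\,\epsilon^2f(s)\,v^\perp,\ t+\epsilon^2\big)\quad\text{for } t<T.$$ In the half-relaxed limit, $Y$ ranges over points at which $u^\epsilon$ is defined. Equation. $\operatorname{curv}(u)=-\operatorname{div}(\nabla u/|\nabla u|)$ (spatial derivatives), and $\varphi(\kappa)=-|\kappa|^\gamma$ for $\kappa\le0$, $\varphi(\kappa)=0$ for $\kappa>0$. The equation is considered for $x\in\mathbb{R}^2$, $t\in(0,T)$. Viscosity subsolution. An upper semicontinuous function $u$ is a viscosity subsolution if whenever $\phi(x,t)$ is smooth and $u-\phi$ has a local maximum at $(x_0,t_0)$, then at $(x_0,t_0)$: $\phi_t-|\nabla\phi|\varphi(\operatorname{curv}(\phi))\ge0$ if $\nabla\phi(x_0,t_0)\ne0$, and $\phi_t\ge0$ if $\nabla\phi(x_0,t_0)=0$.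 (The inequality sign is this way because the equation is a backward, terminal-value problem. The definition does not involve the terminal condition.) *)

theory Defs
  imports "HOL-Analysis.Analysis"
begin

section \<open>Smooth functions, smooth domains, differential operators\<close>

text \<open>For open \<open>S\<close>, \<open>Ck_on n f S\<close> says that all iterated directional derivatives of \<open>f\<close>
  up to order \<open>n\<close> exist and are continuous on \<open>S\<close>.\<close>

primrec Ck_on :: "nat \<Rightarrow> ('a::real_normed_vector \<Rightarrow> 'b::real_normed_vector) \<Rightarrow> 'a set \<Rightarrow> bool" where
  "Ck_on 0 f S \<longleftrightarrow> continuous_on S f"
| "Ck_on (Suc n) f S \<longleftrightarrow> (\<forall>x\<in>S. f differentiable at x) \<and>
     (\<forall>v. Ck_on n (\<lambda>x. frechet_derivative f (at x) v) S)"

definition smooth_on :: "('a::real_normed_vector \<Rightarrow> 'b::real_normed_vector) \<Rightarrow> 'a set \<Rightarrow> bool" where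
  "smooth_on f S \<longleftrightarrow> (\<forall>n. Ck_on n f S)"

definition grad :: "('a::euclidean_space \<Rightarrow> real) \<Rightarrow> 'a \<Rightarrow> 'a" where
  "grad g x = (THE D. GDERIV g x :> D)"

definition divergence :: "((real^2) \<Rightarrow> (real^2)) \<Rightarrow> (real^2) \<Rightarrow> real" where
  "divergence F x = (\<Sum>i\<in>UNIV. frechet_derivative F (at x) (axis i 1) $ i)"

definition curv :: "((real^2) \<Rightarrow> real) \<Rightarrow> (real^2) \<Rightarrow> real" where
  "curv g x = - divergence (\<lambda>y. grad g y /\<^sub>R norm (grad g y)) x"

text \<open>A domain with smooth boundary: near each boundary point the domain is the sublevel set
  of a smooth local defining function without critical points.\<close>

definition smooth_domain :: "(real^2) set \<Rightarrow> bool" where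
  "smooth_domain \<Omega> \<longleftrightarrow> open \<Omega> \<and> connected \<Omega> \<and> \<Omega> \<noteq> {} \<and>
     (\<forall>p\<in>frontier \<Omega>. \<exists>U \<rho>. open U \<and> p \<in> U \<and> smooth_on \<rho> U \<and>
        (\<forall>x\<in>U. grad \<rho> x \<noteq> 0) \<and> \<Omega> \<inter> U = {x\<in>U. \<rho> x < 0})"


section \<open>The game and its value functions\<close>

definition c_gam :: "real \<Rightarrow> real" where
  "c_gam \<gamma> = (1 - \<gamma>) * (2 * \<gamma>) powr (\<gamma> / (1 - \<gamma>))"

definition f_gam :: "real \<Rightarrow> real \<Rightarrow> real" where
  "f_gam \<gamma> s = c_gam \<gamma> * s powr (2 * \<gamma> / (\<gamma> - 1))"

definition step_range :: "real \<Rightarrow> real \<Rightarrow> real \<Rightarrow> real set" where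
  "step_range \<alpha>1 \<alpha>2 \<epsilon> = {\<epsilon> powr \<alpha>1 .. \<epsilon> powr (- \<alpha>2)}"

definition perp :: "real^2 \<Rightarrow> real^2" where
  "perp v = vector [- (v $ 2), v $ 1]"

definition payoff :: "real \<Rightarrow> real \<Rightarrow> ((real^2) \<Rightarrow> real) \<Rightarrow> (real^2) \<Rightarrow> (real^2) \<Rightarrow> real \<Rightarrow> real" where
  "payoff \<gamma> \<epsilon> w x v s =
     (MAX (b, \<beta>) \<in> {-1, 1} \<times> {-1, 1}.
        w (x + (b * \<epsilon> * s) *\<^sub>R v + (\<beta> * \<epsilon>\<^sup>2 * f_gam \<gamma> s) *\<^sub>R perp v))"

text \<open>The minimum is written as an infimum; for the value functions it is attained,
  see \<open>value_fn_attained\<close> below.\<close>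

definition game_step ::
    "real \<Rightarrow> real \<Rightarrow> real \<Rightarrow> real \<Rightarrow> ((real^2) \<Rightarrow> real) \<Rightarrow> (real^2) \<Rightarrow> real" where
  "game_step \<gamma> \<alpha>1 \<alpha>2 \<epsilon> w x =
     (INF (v, s) \<in> {v. norm v = 1} \<times> step_range \<alpha>1 \<alpha>2 \<epsilon>. payoff \<gamma> \<epsilon> w x v s)"

definition game_points :: "real \<Rightarrow> real \<Rightarrow> ((real^2) \<times> real) set" where
  "game_points T \<epsilon> = {(x, t). t \<ge> 0 \<and> (\<exists>k::nat. t = T - real k * \<epsilon>\<^sup>2)}"

text \<open>Only meaningful on \<open>game_points T \<epsilon>\<close> for \<open>\<epsilon> > 0\<close>: at time \<open>T - k \<epsilon>\<^sup>2\<close> there are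
  \<open>k\<close> steps left. The defining backward recursion in \<open>t\<close> is \<open>value_fn_final\<close> and
  \<open>value_fn_step\<close> below.\<close>

definition value_fn ::
    "real \<Rightarrow> real \<Rightarrow> real \<Rightarrow> real \<Rightarrow> ((real^2) \<Rightarrow> real) \<Rightarrow> real \<Rightarrow> (real^2) \<times> real \<Rightarrow> real" where
  "value_fn \<gamma> \<alpha>1 \<alpha>2 T u0 \<epsilon> = (\<lambda>(x, t).
     (game_step \<gamma> \<alpha>1 \<alpha>2 \<epsilon> ^^ (THE k::nat. t = T - real k * \<epsilon>\<^sup>2)) u0 x)"

text \<open>\<open>w \<epsilon>\<close> is regarded as defined on \<open>D \<epsilon>\<close> only. As usual for half-relaxed limits,
  \<open>Y = X\<close> is allowed.\<close>

definition upper_half_relaxed_limit ::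
    "(real \<Rightarrow> 'a::topological_space set) \<Rightarrow> (real \<Rightarrow> 'a \<Rightarrow> real) \<Rightarrow> 'a \<Rightarrow> ereal" where
  "upper_half_relaxed_limit D w X =
     Limsup (inf (nhds X \<times>\<^sub>F at_right 0) (principal {(Y, \<epsilon>). Y \<in> D \<epsilon>}))
       (\<lambda>(Y, \<epsilon>). ereal (w \<epsilon> Y))"

text \<open>The limit is finite for times in \<open>[0, T]\<close> when \<open>\<bar>u0\<bar> \<le> 1\<close>
  (\<open>upper_limit_finite\<close> below), so that the conversion to \<^typ>\<open>real\<close> loses nothing there.\<close>

definition u_bar ::
    "real \<Rightarrow> real \<Rightarrow> real \<Rightarrow> real \<Rightarrow> ((real^2) \<Rightarrow> real) \<Rightarrow> (real^2) \<times> real \<Rightarrow> real" where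
  "u_bar \<gamma> \<alpha>1 \<alpha>2 T u0 X =
     real_of_ereal (upper_half_relaxed_limit (game_points T) (value_fn \<gamma> \<alpha>1 \<alpha>2 T u0) X)"


section \<open>Viscosity subsolutions\<close>

definition upper_semicontinuous_on :: "'a::topological_space set \<Rightarrow> ('a \<Rightarrow> real) \<Rightarrow> bool" where
  "upper_semicontinuous_on S u \<longleftrightarrow>
     (\<forall>X\<in>S. \<forall>a. u X < a \<longrightarrow> (\<forall>\<^sub>F Y in at X within S. u Y < a))"

definition varphi :: "real \<Rightarrow> real \<Rightarrow> real" where
  "varphi \<gamma> \<kappa> = (if \<kappa> \<le> 0 then - (\<bar>\<kappa>\<bar> powr \<gamma>) else 0)"

definition viscosity_subsolution :: "real \<Rightarrow> real \<Rightarrow> ((real^2) \<times> real \<Rightarrow> real) \<Rightarrow> bool" where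
  "viscosity_subsolution \<gamma> T u \<longleftrightarrow>
     upper_semicontinuous_on (UNIV \<times> {0<..<T}) u \<and>
     (\<forall>\<phi> x0 t0.
        smooth_on \<phi> (UNIV \<times> {0<..<T}) \<and> t0 \<in> {0<..<T} \<and>
        (\<forall>\<^sub>F Y in nhds (x0, t0). u Y - \<phi> Y \<le> u (x0, t0) - \<phi> (x0, t0)) \<longrightarrow>
        (let \<phi>_t = deriv (\<lambda>t. \<phi> (x0, t)) t0;
             \<phi>_x = grad (\<lambda>x. \<phi> (x, t0)) x0
         in if \<phi>_x \<noteq> 0
            then \<phi>_t - norm \<phi>_x * varphi \<gamma> (curv (\<lambda>x. \<phi> (x, t0)) x0) \<ge> 0
            else \<phi>_t \<ge> 0))"


section \<open>Sanity checks for the value functions\<close>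

lemma the_steps:
  assumes "\<epsilon> \<noteq> (0::real)"
  shows "(THE k::nat. T - real j * \<epsilon>\<^sup>2 = T - real k * \<epsilon>\<^sup>2) = j"
  using assms by (intro the_equality) auto

lemma value_fn_final:
  assumes "\<epsilon> > 0"
  shows "value_fn \<gamma> \<alpha>1 \<alpha>2 T u0 \<epsilon> (x, T) = u0 x"
  using the_steps[of \<epsilon> T 0] assms by (simp add: value_fn_def)

lemma value_fn_step:
  assumes "\<epsilon> > 0" "(x, t) \<in> game_points T \<epsilon>" "t < T"
  shows "value_fn \<gamma> \<alpha>1 \<alpha>2 T u0 \<epsilon> (x, t) =
    game_step \<gamma> \<alpha>1 \<alpha>2 \<epsilon> (\<lambda>y. value_fn \<gamma> \<alpha>1 \<alpha>2 T u0 \<epsilon> (y, t + \<epsilon>\<^sup>2)) x"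
proof -
  obtain k :: nat where k: "t = T - real k * \<epsilon>\<^sup>2"
    using assms(2) by (auto simp: game_points_def)
  with assms(3) obtain j where j: "k = Suc j"
    by (cases k) auto
  have t: "t + \<epsilon>\<^sup>2 = T - real j * \<epsilon>\<^sup>2"
    by (simp add: k j algebra_simps)
  show ?thesis
    using the_steps[of \<epsilon> T k] the_steps[of \<epsilon> T j] assms(1)
    unfolding value_fn_def t prod.case by (simp add: k j)
qed

lemma payoff_max:
  "payoff \<gamma> \<epsilon> w x v s =
    max (max (w (x + ((-1) * \<epsilon> * s) *\<^sub>R v + ((-1) * \<epsilon>\<^sup>2 * f_gam \<gamma> s) *\<^sub>R perp v))
             (w (x + ((-1) * \<epsilon> * s) *\<^sub>R v + (1 * \<epsilon>\<^sup>2 * f_gam \<gamma> s) *\<^sub>R perp v)))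
        (max (w (x + (1 * \<epsilon> * s) *\<^sub>R v + ((-1) * \<epsilon>\<^sup>2 * f_gam \<gamma> s) *\<^sub>R perp v))
             (w (x + (1 * \<epsilon> * s) *\<^sub>R v + (1 * \<epsilon>\<^sup>2 * f_gam \<gamma> s) *\<^sub>R perp v)))"
proof -
  have "{-1, 1::real} \<times> {-1, 1::real} = {(-1,-1), (-1,1), (1,-1), (1,1)}"
    by auto
  then show ?thesis
    unfolding payoff_def by (simp add: max.assoc)
qed

lemma payoff_bounds:
  assumes "\<And>y. \<bar>w y\<bar> \<le> c"
  shows "\<bar>payoff \<gamma> \<epsilon> w x v s\<bar> \<le> c"
proof -
  have max: "\<bar>max a b\<bar> \<le> c" if "\<bar>a\<bar> \<le> c" "\<bar>b\<bar> \<le> c" for a b :: real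
    using that by (simp add: max_def)
  show ?thesis
    unfolding payoff_max by (intro max assms)
qed

lemma continuous_on_perp [continuous_intros]:
  assumes "continuous_on S g" shows "continuous_on S (\<lambda>x. perp (g x))"
proof -
  have perp: "perp = (\<lambda>v. \<chi> i. if i = 1 then - (v $ 2) else v $ 1)"
    by (auto simp: perp_def vec_eq_iff forall_2)
  have "continuous_on S (\<lambda>x. \<chi> i. if i = (1::2) then - (g x $ 2) else g x $ 1)"
  proof (rule continuous_on_vec_lambda)
    fix i :: 2
    show "continuous_on S (\<lambda>x. if i = 1 then - (g x $ 2) else g x $ 1)"
      using assms by (cases "i = 1") (auto intro!: continuous_on_minus continuous_on_component)
  qed
  then show ?thesis unfolding perp .
qed

lemma step_range_pos:
  assumes "0 < \<epsilon>" "s \<in> step_range \<alpha>1 \<alpha>2 \<epsilon>" shows "s > 0"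
proof -
  have "0 < \<epsilon> powr \<alpha>1" using assms(1) by simp
  also have "\<dots> \<le> s" using assms(2) by (simp add: step_range_def)
  finally show ?thesis .
qed

lemma step_range_ne:
  assumes "0 < \<epsilon>" "\<epsilon> < 1" "0 < \<alpha>1" "0 < \<alpha>2"
  shows "\<epsilon> powr \<alpha>1 \<in> step_range \<alpha>1 \<alpha>2 \<epsilon>"
  using assms by (auto simp: step_range_def intro!: powr_mono')

lemma game_step_attained:
  assumes "0 < \<epsilon>" "\<epsilon> < 1" "0 < \<alpha>1" "0 < \<alpha>2" and w: "continuous_on UNIV w"
  shows "\<exists>v s. norm v = 1 \<and> s \<in> step_range \<alpha>1 \<alpha>2 \<epsilon> \<and>
     game_step \<gamma> \<alpha>1 \<alpha>2 \<epsilon> w x = payoff \<gamma> \<epsilon> w x v s \<and>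
     (\<forall>v' s'. norm v' = 1 \<longrightarrow> s' \<in> step_range \<alpha>1 \<alpha>2 \<epsilon> \<longrightarrow>
        payoff \<gamma> \<epsilon> w x v s \<le> payoff \<gamma> \<epsilon> w x v' s')"
proof -
  let ?K = "{v::real^2. norm v = 1} \<times> step_range \<alpha>1 \<alpha>2 \<epsilon>"
  let ?p = "\<lambda>(v, s). payoff \<gamma> \<epsilon> w x v s"
  have sph: "{v::real^2. norm v = 1} = sphere 0 1"
    by auto
  have "compact ?K"
    unfolding sph step_range_def by (intro compact_Times) auto
  moreover have "(axis 1 1, \<epsilon> powr \<alpha>1) \<in> ?K"
    using step_range_ne[OF assms(1-4)] by simp
  then have "?K \<noteq> {}"
    by blast
  moreover have "continuous_on ?K ?p"
  proof -
    have c: "continuous_on ?K (\<lambda>z. w (x + (b * \<epsilon> * snd z) *\<^sub>R fst z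
        + (\<beta> * \<epsilon>\<^sup>2 * f_gam \<gamma> (snd z)) *\<^sub>R perp (fst z)))" for b \<beta>
    proof (rule continuous_on_compose2[OF w])
      show "continuous_on ?K (\<lambda>z. x + (b * \<epsilon> * snd z) *\<^sub>R fst z
        + (\<beta> * \<epsilon>\<^sup>2 * f_gam \<gamma> (snd z)) *\<^sub>R perp (fst z))"
        unfolding f_gam_def
        by (intro continuous_intros) (use step_range_pos[OF assms(1)] in fastforce)+
    qed auto
    show ?thesis
      unfolding case_prod_beta payoff_max
      by (intro continuous_on_max c)
  qed
  ultimately obtain z where z: "z \<in> ?K" "\<And>z'. z' \<in> ?K \<Longrightarrow> ?p z \<le> ?p z'"
    using continuous_attains_inf[of ?K ?p] by blast
  have "game_step \<gamma> \<alpha>1 \<alpha>2 \<epsilon> w x = ?p z"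
    unfolding game_step_def using z by (intro cInf_eq_minimum) auto
  then show ?thesis
    using z by (intro exI[of _ "fst z"] exI[of _ "snd z"]) (auto simp: case_prod_beta)
qed

lemma game_step_lipschitz:
  assumes e: "0 < \<epsilon>" "\<epsilon> < 1" "0 < \<alpha>1" "0 < \<alpha>2" and w: "L-lipschitz_on UNIV w"
  shows "L-lipschitz_on UNIV (game_step \<gamma> \<alpha>1 \<alpha>2 \<epsilon> w)"
proof -
  have cw: "continuous_on UNIV w"
    using w by (rule lipschitz_on_continuous_on)
  have L: "w (x + p + q) \<le> w (y + p + q) + L * dist x y" for x y p q
    using lipschitz_onD[OF w, of "x + p + q" "y + p + q"]
    by (simp add: dist_norm abs_le_iff)
  have max: "max a b \<le> max a' b' + d" if "a \<le> a' + d" "b \<le> b' + d" for a a' b b' d :: real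
    using that by (simp add: max_def)
  have P: "payoff \<gamma> \<epsilon> w x v s \<le> payoff \<gamma> \<epsilon> w y v s + L * dist x y" for x y v s
    unfolding payoff_max
    by (rule max) (rule max; rule L)+
  have G: "game_step \<gamma> \<alpha>1 \<alpha>2 \<epsilon> w x \<le> game_step \<gamma> \<alpha>1 \<alpha>2 \<epsilon> w y + L * dist x y" for x y
  proof -
    obtain v s where y: "norm v = 1" "s \<in> step_range \<alpha>1 \<alpha>2 \<epsilon>"
        "game_step \<gamma> \<alpha>1 \<alpha>2 \<epsilon> w y = payoff \<gamma> \<epsilon> w y v s"
      using game_step_attained[OF e cw] by blast
    have "game_step \<gamma> \<alpha>1 \<alpha>2 \<epsilon> w x \<le> payoff \<gamma> \<epsilon> w x v s"
      using game_step_attained[OF e cw, of \<gamma> x] y by metis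
    with P[of x v s y] y show ?thesis by linarith
  qed
  show ?thesis
  proof (rule lipschitz_onI)
    fix x y
    show "dist (game_step \<gamma> \<alpha>1 \<alpha>2 \<epsilon> w x) (game_step \<gamma> \<alpha>1 \<alpha>2 \<epsilon> w y) \<le> L * dist x y"
      using G[of x y] G[of y x] by (simp add: dist_real_def dist_commute abs_le_iff)
  qed (use w lipschitz_on_nonneg in blast)
qed

lemma value_fn_attained:
  fixes \<gamma> :: real
  assumes e: "0 < \<epsilon>" "\<epsilon> < 1" "0 < \<alpha>1" "0 < \<alpha>2" and u0: "L-lipschitz_on UNIV u0"
    and x: "(x, t) \<in> game_points T \<epsilon>" "t < T"
  defines "U \<equiv> value_fn \<gamma> \<alpha>1 \<alpha>2 T u0 \<epsilon>"
  shows "\<exists>v s. norm v = 1 \<and> s \<in> step_range \<alpha>1 \<alpha>2 \<epsilon> \<and>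
     U (x, t) = payoff \<gamma> \<epsilon> (\<lambda>y. U (y, t + \<epsilon>\<^sup>2)) x v s \<and>
     (\<forall>v' s'. norm v' = 1 \<longrightarrow> s' \<in> step_range \<alpha>1 \<alpha>2 \<epsilon> \<longrightarrow>
        U (x, t) \<le> payoff \<gamma> \<epsilon> (\<lambda>y. U (y, t + \<epsilon>\<^sup>2)) x v' s')"
proof -
  have lip: "L-lipschitz_on UNIV ((game_step \<gamma> \<alpha>1 \<alpha>2 \<epsilon> ^^ k) u0)" for k
    by (induction k) (auto simp: u0 intro!: game_step_lipschitz e)
  have "L-lipschitz_on UNIV (\<lambda>y. U (y, t + \<epsilon>\<^sup>2))"
    unfolding U_def value_fn_def prod.case by (rule lip)
  then have "continuous_on UNIV (\<lambda>y. U (y, t + \<epsilon>\<^sup>2))"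
    by (rule lipschitz_on_continuous_on)
  from game_step_attained[OF e this, of \<gamma> x] show ?thesis
    using value_fn_step[OF e(1) x, of \<gamma> \<alpha>1 \<alpha>2 u0] unfolding U_def by metis
qed

lemma game_step_bounds:
  assumes e: "0 < \<epsilon>" "\<epsilon> < 1" "0 < \<alpha>1" "0 < \<alpha>2" and w: "\<And>x. \<bar>w x\<bar> \<le> 1"
  shows "\<bar>game_step \<gamma> \<alpha>1 \<alpha>2 \<epsilon> w x\<bar> \<le> 1"
proof -
  let ?K = "{v::real^2. norm v = 1} \<times> step_range \<alpha>1 \<alpha>2 \<epsilon>"
  let ?p = "\<lambda>(v, s). payoff \<gamma> \<epsilon> w x v s"
  have ne: "(axis 1 1, \<epsilon> powr \<alpha>1) \<in> ?K"
    using step_range_ne[OF e] by simp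
  have b: "- 1 \<le> ?p z" "?p z \<le> 1" for z
    using payoff_bounds[of w 1 \<gamma> \<epsilon> x "fst z" "snd z", OF w] by (simp_all add: case_prod_beta abs_le_iff)
  have "- 1 \<le> (INF z\<in>?K. ?p z)"
    by (rule cINF_greatest) (use ne in blast, rule b)
  moreover have "bdd_below (?p ` ?K)"
    by (rule bdd_belowI2) (rule b)
  then have "(INF z\<in>?K. ?p z) \<le> ?p (axis 1 1, \<epsilon> powr \<alpha>1)"
    using ne by (rule cINF_lower)
  then have "(INF z\<in>?K. ?p z) \<le> 1"
    using b(2) by (rule order.trans)
  ultimately show ?thesis
    by (simp add: game_step_def)
qed

lemma value_fn_bounds:
  assumes "0 < \<epsilon>" "\<epsilon> < 1" "0 < \<alpha>1" "0 < \<alpha>2" and u0: "\<And>x. \<bar>u0 x\<bar> \<le> 1"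
  shows "\<bar>value_fn \<gamma> \<alpha>1 \<alpha>2 T u0 \<epsilon> Y\<bar> \<le> 1"
proof -
  have "\<bar>(game_step \<gamma> \<alpha>1 \<alpha>2 \<epsilon> ^^ k) u0 x\<bar> \<le> 1" for k x
    by (induction k arbitrary: x) (simp_all add: u0 game_step_bounds assms(1-4))
  then show ?thesis
    by (simp add: value_fn_def case_prod_beta)
qed

lemma upper_limit_finite:
  assumes a: "0 < \<alpha>1" "0 < \<alpha>2" and u0: "\<And>x. \<bar>u0 x\<bar> \<le> 1" and t: "0 \<le> t" "t \<le> T"
  shows "\<bar>upper_half_relaxed_limit (game_points T) (value_fn \<gamma> \<alpha>1 \<alpha>2 T u0) (x, t)\<bar> \<le> 1"
proof -
  let ?P = "{(Y, \<epsilon>). Y \<in> game_points T \<epsilon>}"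
  let ?F = "inf (nhds (x, t) \<times>\<^sub>F at_right 0) (principal ?P)"
  let ?U = "\<lambda>(Y, \<epsilon>). ereal (value_fn \<gamma> \<alpha>1 \<alpha>2 T u0 \<epsilon> Y)"
  have "\<forall>\<^sub>F \<epsilon> in at_right (0::real). 0 < \<epsilon> \<and> \<epsilon> < 1"
    unfolding eventually_at_right_field by (intro exI[of _ 1]) auto
  from filterlim_iff[THEN iffD1, OF filterlim_snd[of "at_right (0::real)" "nhds (x, t)"],
      rule_format, OF this]
  have "\<forall>\<^sub>F z in nhds (x, t) \<times>\<^sub>F at_right (0::real). 0 < snd z \<and> snd z < 1" .
  then have ev: "\<forall>\<^sub>F z in ?F. \<bar>value_fn \<gamma> \<alpha>1 \<alpha>2 T u0 (snd z) (fst z)\<bar> \<le> 1"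
    unfolding eventually_inf_principal
    by (elim eventually_mono) (auto intro!: value_fn_bounds a u0)
  have ub: "Limsup ?F ?U \<le> 1"
    by (rule Limsup_bounded, rule eventually_mono[OF ev]) (auto simp: case_prod_beta)
  have "?F \<noteq> bot"
  proof
    assume "?F = bot"
    then have "\<forall>\<^sub>F z in nhds (x, t) \<times>\<^sub>F at_right 0. z \<notin> ?P"
      by (simp add: trivial_limit_def eventually_inf_principal)
    then obtain P Q where P: "eventually P (nhds (x, t))" and Q: "eventually Q (at_right (0::real))"
      and PQ: "\<And>Y \<epsilon>. P Y \<Longrightarrow> Q \<epsilon> \<Longrightarrow> (Y, \<epsilon>) \<notin> ?P"
      unfolding eventually_prod_filter by blast
    obtain d where d: "d > 0" "\<And>Y. dist Y (x, t) < d \<Longrightarrow> P Y"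
      using P unfolding eventually_nhds_metric by blast
    obtain q where q: "q > 0" "\<And>\<epsilon>. 0 < \<epsilon> \<Longrightarrow> \<epsilon> < q \<Longrightarrow> Q \<epsilon>"
      using Q unfolding eventually_at_right_field by blast
    define \<epsilon> where "\<epsilon> = Min {q / 2, d / 2, 1 / 2}"
    have \<epsilon>: "0 < \<epsilon>" "\<epsilon> < q" "\<epsilon> < d" "\<epsilon> < 1"
      using d(1) q(1) by (auto simp: \<epsilon>_def min_def)
    define k where "k = nat \<lfloor>(T - t) / \<epsilon>\<^sup>2\<rfloor>"
    have k: "real k \<le> (T - t) / \<epsilon>\<^sup>2" "(T - t) / \<epsilon>\<^sup>2 < real k + 1"
      using t by (auto simp: k_def of_nat_nat)
    then have k': "real k * \<epsilon>\<^sup>2 \<le> T - t" "T - t < (real k + 1) * \<epsilon>\<^sup>2"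
      using \<epsilon>(1) by (auto simp: field_simps)
    have "\<epsilon>\<^sup>2 \<le> \<epsilon>"
      using \<epsilon> by (simp add: power2_eq_square mult_le_cancel_left1)
    with k' \<epsilon> have "dist (T - real k * \<epsilon>\<^sup>2) t < d"
      by (auto simp: dist_real_def algebra_simps)
    then have "P (x, T - real k * \<epsilon>\<^sup>2)"
      by (intro d(2)) (simp add: dist_Pair_Pair)
    moreover have "((x, T - real k * \<epsilon>\<^sup>2), \<epsilon>) \<in> ?P"
      using k' t by (auto simp: game_points_def)
    ultimately show False
      using PQ q(2)[of \<epsilon>] \<epsilon> by blast
  qed
  then have "- 1 \<le> Limsup ?F ?U"
    by (rule le_Limsup, intro eventually_mono[OF ev]) (auto simp: case_prod_beta one_ereal_def abs_le_iff)
  with ub show ?thesis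
    unfolding upper_half_relaxed_limit_def by (cases "Limsup ?F ?U") (auto simp: one_ereal_def abs_le_iff)
qed

end

theory Submission
  imports Defs
begin

text \<open>
  The value functions are minima over the moves \<open>(v, s)\<close>, so bounding them from above only takes one good
  move. Suppose that \<open>u_bar - \<phi>\<close> has a local maximum at \<open>X\<close> and the subsolution inequality fails there.
  If \<open>v\<close> is tangential to the level line of \<open>\<phi>\<close>, a move with step size \<open>s\<close> changes \<open>\<phi>\<close> by at most
  \<open>\<epsilon>\<^sup>2\<close> times the drift \<open>\<tau> + f_gam \<gamma> s * norm g + s\<^sup>2 / 2 * (v \<bullet> (H *v v))\<close>, up to \<open>o(\<epsilon>\<^sup>2)\<close>, whatever
  the opponent answers (\<open>move_expansion\<close>); here \<open>g\<close>, \<open>H\<close> and \<open>\<tau>\<close> are the spatial gradient, the spatial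
  Hessian and the time derivative of \<open>\<phi>\<close>. The second derivative along the tangent is \<open>- norm g\<close> times the
  curvature (\<open>curv_eq_tangential_second_derivative\<close>), and for negative curvature \<open>f_gam\<close> is designed so that
  the best choice of \<open>s\<close> turns the drift into the left-hand side of the equation (\<open>f_gam_optimal_step\<close>).
  Failure of the inequality therefore yields a step size with negative drift
  (\<open>step_size_with_negative_drift\<close>). This step size does not depend on \<open>\<epsilon>\<close>, so it is admissible for all small
  \<open>\<epsilon>\<close> because the admissible ranges exhaust the positive half-line.

  A quadratic penalty added to \<open>\<phi>\<close>, small enough to keep the drift negative, gives a function \<open>\<psi>\<close> for which
  the maximum of \<open>u_bar - \<psi>\<close> is strict. Then points at which the value functions minus \<open>\<psi>\<close> are maximal up to
  \<open>\<epsilon>\<^sup>3\<close> converge to \<open>X\<close> along a sequence \<open>\<epsilon> \<rightarrow> 0\<close> (\<open>near_maximizers_tendsto\<close>). Playing the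
  good move from such a point does not decrease the value function against the best answer of the opponent
  (\<open>value_fn_le_after_move\<close>), so near-maximality says that \<open>\<psi>\<close> decreases by at most \<open>\<epsilon>\<^sup>3\<close>. After division
  by \<open>\<epsilon>\<^sup>2\<close> the limit contradicts the negative drift (\<open>move_limit\<close>).
\<close>

section \<open>Half-relaxed limits\<close>

text \<open>The neighbourhood \<open>U\<close> of \<open>X\<close> and the threshold \<open>q\<close> for \<open>\<epsilon>\<close> can be chosen independently of each
  other. This is what makes \<open>U\<close> usable for the limit at the other points of \<open>U\<close> as well.\<close>

lemma half_relaxed_filter_eventually:
  "eventually P (inf (nhds X \<times>\<^sub>F at_right (0::real)) (principal {(Y, \<epsilon>). Y \<in> D \<epsilon>})) \<longleftrightarrow>
   (\<exists>U q. open U \<and> X \<in> U \<and> 0 < q \<and> (\<forall>Y\<in>U. \<forall>\<epsilon>. 0 < \<epsilon> \<and> \<epsilon> < q \<and> Y \<in> D \<epsilon> \<longrightarrow> P (Y, \<epsilon>)))"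
  (is "?L \<longleftrightarrow> ?R")
proof
  assume ?L
  then obtain A B where A: "eventually A (nhds X)" and B: "eventually B (at_right (0::real))"
    and AB: "\<And>Y \<epsilon>. A Y \<Longrightarrow> B \<epsilon> \<Longrightarrow> Y \<in> D \<epsilon> \<Longrightarrow> P (Y, \<epsilon>)"
    unfolding eventually_inf_principal eventually_prod_filter by auto
  obtain U where "open U" "X \<in> U" "\<And>Y. Y \<in> U \<Longrightarrow> A Y"
    using A unfolding eventually_nhds by blast
  moreover obtain q where "0 < q" "\<And>\<epsilon>. 0 < \<epsilon> \<Longrightarrow> \<epsilon> < q \<Longrightarrow> B \<epsilon>"
    using B unfolding eventually_at_right_field by blast
  ultimately show ?R
    using AB by blast
next
  assume ?R
  then obtain U q where U: "open U" "X \<in> U" "0 < q"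
    and P: "\<And>Y \<epsilon>. Y \<in> U \<Longrightarrow> 0 < \<epsilon> \<Longrightarrow> \<epsilon> < q \<Longrightarrow> Y \<in> D \<epsilon> \<Longrightarrow> P (Y, \<epsilon>)"
    by blast
  have "eventually (\<lambda>Y. Y \<in> U) (nhds X)"
    using U eventually_nhds by blast
  moreover have "eventually (\<lambda>\<epsilon>. 0 < \<epsilon> \<and> \<epsilon> < q) (at_right (0::real))"
    unfolding eventually_at_right_field using U by blast
  ultimately show ?L
    unfolding eventually_inf_principal eventually_prod_filter using P by auto
qed

lemma upper_half_relaxed_limit_lessE:
  assumes "upper_half_relaxed_limit D w X < ereal a"
  obtains U q where "open U" "X \<in> U" "0 < q"
    "\<And>Y \<epsilon>. Y \<in> U \<Longrightarrow> 0 < \<epsilon> \<Longrightarrow> \<epsilon> < q \<Longrightarrow> Y \<in> D \<epsilon> \<Longrightarrow> w \<epsilon> Y < a"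
  using Limsup_lessD[OF assms[unfolded upper_half_relaxed_limit_def]]
  unfolding half_relaxed_filter_eventually by auto

lemma upper_half_relaxed_limit_leI:
  assumes "open U" "X \<in> U" "0 < q"
    "\<And>Y \<epsilon>. Y \<in> U \<Longrightarrow> 0 < \<epsilon> \<Longrightarrow> \<epsilon> < q \<Longrightarrow> Y \<in> D \<epsilon> \<Longrightarrow> w \<epsilon> Y \<le> a"
  shows "upper_half_relaxed_limit D w X \<le> ereal a"
  unfolding upper_half_relaxed_limit_def
  by (rule Limsup_bounded) (use assms in \<open>auto simp: half_relaxed_filter_eventually\<close>)

text \<open>A limit superior is attained along a sequence: if the values close to \<open>(X, 0)\<close> all stayed
  below \<open>c - 1 / (n + 1)\<close>, then so would the limit.\<close>

lemma upper_half_relaxed_limit_realizing_sequence: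
  fixes X :: "'a::metric_space"
  assumes "upper_half_relaxed_limit D w X = ereal c"
  obtains Y e where "Y \<longlonglongrightarrow> X" "e \<longlonglongrightarrow> 0" "\<And>n. 0 < e n" "\<And>n. e n < 1" "\<And>n. Y n \<in> D (e n)"
    "\<And>n. c - 1 / real (Suc n) < w (e n) (Y n)"
proof -
  have "\<exists>Y \<epsilon>. dist Y X < 1 / real (Suc n) \<and> 0 < \<epsilon> \<and> \<epsilon> < 1 / real (Suc n) \<and> Y \<in> D \<epsilon> \<and>
      c - 1 / real (Suc n) < w \<epsilon> Y" for n
  proof (rule ccontr)
    let ?r = "1 / real (Suc n)"
    assume "\<not> ?thesis"
    then have none: "w \<epsilon> Y \<le> c - ?r" if "dist Y X < ?r" "0 < \<epsilon>" "\<epsilon> < ?r" "Y \<in> D \<epsilon>" for Y \<epsilon>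
      using that by (meson not_less)
    have "upper_half_relaxed_limit D w X \<le> ereal (c - ?r)"
      by (rule upper_half_relaxed_limit_leI[of "ball X ?r" X ?r])
        (auto intro!: none simp: dist_commute simp del: of_nat_Suc)
    with assms show False
      by simp
  qed
  then obtain Y e where Ye: "\<And>n. dist (Y n) X < 1 / real (Suc n)" "\<And>n. 0 < e n"
    "\<And>n. e n < 1 / real (Suc n)" "\<And>n. Y n \<in> D (e n)" "\<And>n. c - 1 / real (Suc n) < w (e n) (Y n)"
    by metis
  have lim: "(\<lambda>n. 1 / real (Suc n)) \<longlonglongrightarrow> 0"
    using LIMSEQ_inverse_real_of_nat by (simp add: inverse_eq_divide)
  have "(\<lambda>n. dist (Y n) X) \<longlonglongrightarrow> 0"
    by (rule tendsto_sandwich[OF _ _ tendsto_const lim]) (use less_imp_le[OF Ye(1)] in simp_all)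
  then have "Y \<longlonglongrightarrow> X"
    using tendsto_dist_iff by blast
  moreover have "e \<longlonglongrightarrow> 0"
    by (rule tendsto_sandwich[OF _ _ tendsto_const lim]) (use less_imp_le[OF Ye(2)] less_imp_le[OF Ye(3)] in simp_all)
  moreover have "e n < 1" for n
    using Ye(3)[of n] by (rule less_le_trans) simp
  ultimately show thesis
    using Ye that by blast
qed

lemma upper_half_relaxed_limit_along_sequence:
  assumes "upper_half_relaxed_limit D w X < ereal a"
    and "Z \<longlonglongrightarrow> X" "e \<longlonglongrightarrow> 0" "\<And>n. 0 < e n" "\<And>n. Z n \<in> D (e n)"
  shows "\<forall>\<^sub>F n in sequentially. w (e n) (Z n) < a"
proof -
  obtain U q where U: "open U" "X \<in> U" "0 < q"
    "\<And>Y \<epsilon>. Y \<in> U \<Longrightarrow> 0 < \<epsilon> \<Longrightarrow> \<epsilon> < q \<Longrightarrow> Y \<in> D \<epsilon> \<Longrightarrow> w \<epsilon> Y < a"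
    using upper_half_relaxed_limit_lessE[OF assms(1)] by blast
  have "\<forall>\<^sub>F n in sequentially. Z n \<in> U" "\<forall>\<^sub>F n in sequentially. e n < q"
    using topological_tendstoD[OF assms(2) U(1,2)] order_tendstoD(2)[OF assms(3) U(3)] by blast+
  then show ?thesis
    by eventually_elim (use U(4) assms(4,5) in blast)
qed

lemma upper_semicontinuous_upper_half_relaxed_limit:
  assumes "\<And>X. X \<in> S \<Longrightarrow> upper_half_relaxed_limit D w X = ereal (u X)"
  shows "upper_semicontinuous_on S u"
  unfolding upper_semicontinuous_on_def
proof (intro ballI allI impI)
  fix X a assume X: "X \<in> S" and "u X < a"
  then obtain a' where a': "u X < a'" "a' < a"
    using dense by blast
  then have "upper_half_relaxed_limit D w X < ereal a'"
    using assms[OF X] by simp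
  then obtain U q where U: "open U" "X \<in> U" "0 < q"
    "\<And>Y \<epsilon>. Y \<in> U \<Longrightarrow> 0 < \<epsilon> \<Longrightarrow> \<epsilon> < q \<Longrightarrow> Y \<in> D \<epsilon> \<Longrightarrow> w \<epsilon> Y < a'"
    using upper_half_relaxed_limit_lessE by blast
  have "u Y < a" if "Y \<in> U" "Y \<in> S" for Y
  proof -
    have "upper_half_relaxed_limit D w Y \<le> ereal a'"
      by (rule upper_half_relaxed_limit_leI[of U Y q]) (use U that less_imp_le in blast)+
    with assms[OF that(2)] a' show ?thesis
      by simp
  qed
  then show "\<forall>\<^sub>F Y in at X within S. u Y < a"
    unfolding eventually_at_topological using U by blast
qed

section \<open>The step cost and its optimal step size\<close>

lemma c_gam_nonneg: "0 < \<gamma> \<Longrightarrow> \<gamma> < 1 \<Longrightarrow> 0 \<le> c_gam \<gamma>"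
  by (simp add: c_gam_def)

lemma f_gam_nonneg: "0 < \<gamma> \<Longrightarrow> \<gamma> < 1 \<Longrightarrow> 0 \<le> f_gam \<gamma> s"
  by (simp add: f_gam_def c_gam_nonneg)

text \<open>For curvature \<open>- k\<close> a step of size \<open>s\<close> along the level line changes the test function, relative to
  \<open>\<epsilon>\<^sup>2\<close> and the length of the gradient, by \<open>s\<^sup>2 k / 2\<close>, and the opponent's normal displacement adds
  \<open>f_gam \<gamma> s\<close>. The step size below is the critical point of the sum: there
  \<open>s\<^sup>2 k / 2 = \<gamma> k powr \<gamma>\<close> and \<open>f_gam \<gamma> s = (1 - \<gamma>) k powr \<gamma>\<close>, and the constant \<open>c_gam \<gamma>\<close>
  is made for these two numbers to add up to \<open>k powr \<gamma>\<close>.\<close>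

lemma f_gam_optimal_step:
  assumes "0 < \<gamma>" "\<gamma> < 1" "0 < k"
  defines "s \<equiv> sqrt (2 * \<gamma> * k powr (\<gamma> - 1))"
  shows "f_gam \<gamma> s + s\<^sup>2 * k / 2 = k powr \<gamma>"
proof -
  have s2: "s\<^sup>2 = 2 * \<gamma> * k powr (\<gamma> - 1)"
    using assms by (simp add: s_def)
  have s: "s = (2 * \<gamma> * k powr (\<gamma> - 1)) powr (1/2)"
    unfolding s_def using assms by (simp add: powr_half_sqrt)
  have e: "1 / 2 * (2 * \<gamma> / (\<gamma> - 1)) = - (\<gamma> / (1 - \<gamma>))" "- ((\<gamma> - 1) * \<gamma> / (1 - \<gamma>)) = \<gamma>"
    using assms(2) by (simp_all add: divide_simps) (simp_all add: algebra_simps)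
  have "s powr (2 * \<gamma> / (\<gamma> - 1)) = (2 * \<gamma> * k powr (\<gamma> - 1)) powr (- (\<gamma> / (1 - \<gamma>)))"
    unfolding s powr_powr e(1) ..
  also have "\<dots> = (2 * \<gamma>) powr (- (\<gamma> / (1 - \<gamma>))) * k powr \<gamma>"
    using assms(1) by (subst powr_mult) (auto simp: powr_powr e(2))
  finally have "f_gam \<gamma> s = (1 - \<gamma>) * k powr \<gamma>"
    using assms(1) by (simp add: f_gam_def c_gam_def powr_minus)
  moreover have "k powr (\<gamma> - 1) * k = k powr \<gamma>"
    using assms(3) by (simp add: powr_mult_base[of k, symmetric] powr_diff)
  ultimately show ?thesis
    unfolding s2 by (simp add: algebra_simps)
qed

lemma f_gam_tendsto_0:
  assumes "0 < \<gamma>" "\<gamma> < 1"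
  shows "(f_gam \<gamma> \<longlongrightarrow> 0) at_top"
proof -
  have "((\<lambda>s. s powr (2 * \<gamma> / (\<gamma> - 1))) \<longlongrightarrow> 0) at_top"
    by (rule tendsto_neg_powr) (use assms in \<open>auto simp: divide_simps filterlim_ident\<close>)
  from tendsto_mult_right_zero[OF this, of "c_gam \<gamma>"] show ?thesis
    unfolding f_gam_def by (rule tendsto_cong[THEN iffD1, rotated]) auto
qed

lemma step_range_eventually:
  assumes "0 < s" "0 < \<alpha>1" "0 < \<alpha>2" and e: "e \<longlonglongrightarrow> 0" "\<And>n. 0 < e n"
  shows "\<forall>\<^sub>F n in sequentially. s \<in> step_range \<alpha>1 \<alpha>2 (e n)"
proof -
  have "(\<lambda>n. e n powr \<alpha>) \<longlonglongrightarrow> 0 powr \<alpha>" if "0 < \<alpha>" for \<alpha>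
    by (rule tendsto_powr'[OF e(1) tendsto_const])
      (use that e(2) less_imp_le in \<open>auto intro!: eventuallyI\<close>)
  from this[OF assms(2)] this[OF assms(3)]
  have "\<forall>\<^sub>F n in sequentially. e n powr \<alpha>1 < s" "\<forall>\<^sub>F n in sequentially. e n powr \<alpha>2 < 1 / s"
    using assms(1) by (auto intro: order_tendstoD(2))
  then show ?thesis
  proof eventually_elim
    case (elim n)
    have "s * e n powr \<alpha>2 \<le> 1"
      using elim(2) assms(1) by (simp add: field_simps)
    then have "s \<le> e n powr (- \<alpha>2)"
      using e(2)[of n] by (simp add: powr_minus field_simps)
    with elim show ?case
      by (simp add: step_range_def)
  qed
qed

section \<open>Curvature as a second derivative along the level line\<close>

lemma norm_perp: "norm (perp v) = norm v"
  by (simp add: perp_def norm_eq_sqrt_inner inner_vec_def sum_2 add.commute)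

lemma inner_perp: "v \<bullet> perp v = 0"
  by (simp add: perp_def inner_vec_def sum_2)

lemma grad_eqI: "GDERIV u x :> D \<Longrightarrow> grad u x = D"
  unfolding grad_def gderiv_def
  by (rule the_equality) (auto dest: has_derivative_unique simp: fun_eq_iff vector_eq_ldot)

lemma quadratic_form_2:
  fixes v :: "real^2" and M :: "real^2^2"
  shows "v \<bullet> (M *v v) = (v$1)\<^sup>2 * M$1$1 + v$1 * v$2 * (M$1$2 + M$2$1) + (v$2)\<^sup>2 * M$2$2"
  by (simp add: inner_vec_def matrix_vector_mult_def sum_2 power2_eq_square algebra_simps)

text \<open>In the plane the unit vectors orthogonal to \<open>g \<noteq> 0\<close> are \<open>\<plusminus> perp g / norm g\<close>, and a quadratic form
  does not see the sign.\<close>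

lemma tangent_quadratic_form:
  fixes v g :: "real^2"
  assumes "norm v = 1" "v \<bullet> g = 0"
  shows "(norm g)\<^sup>2 * (v \<bullet> (M *v v)) = perp g \<bullet> (M *v perp g)"
proof -
  have v: "(v$1)\<^sup>2 + (v$2)\<^sup>2 = 1" and vg: "v$1 * g$1 + v$2 * g$2 = 0"
    using assms by (simp_all add: norm_eq_1 inner_vec_def sum_2 power2_eq_square)
  have "((g$1)\<^sup>2 + (g$2)\<^sup>2) * (v$1)\<^sup>2 = (g$2)\<^sup>2"
    "((g$1)\<^sup>2 + (g$2)\<^sup>2) * (v$1 * v$2) = - (g$1 * g$2)"
    "((g$1)\<^sup>2 + (g$2)\<^sup>2) * (v$2)\<^sup>2 = (g$1)\<^sup>2"
    using v vg by algebra+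
  moreover have "(norm g)\<^sup>2 = (g$1)\<^sup>2 + (g$2)\<^sup>2"
    by (simp add: power2_norm_eq_inner inner_vec_def sum_2 power2_eq_square[of "_ $ _"])
  ultimately show ?thesis
    unfolding quadratic_form_2 by (simp add: perp_def distrib_left mult.assoc[symmetric])
qed

text \<open>The divergence of \<open>g / norm g\<close> is the trace of \<open>M\<close> minus its value on the unit normal, divided by
  the length of \<open>g\<close>; in the plane that difference is the value of \<open>M\<close> on the unit tangent.\<close>

lemma curv_eq_tangential_second_derivative:
  fixes u :: "real^2 \<Rightarrow> real" and M :: "real^2^2"
  assumes u: "\<And>y. GDERIV u y :> g y" and g: "(g has_derivative (*v) M) (at x)"
    and ne: "g x \<noteq> 0" and v: "norm v = 1" "v \<bullet> g x = 0"
  shows "norm (g x) * curv u x = - (v \<bullet> (M *v v))"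
proof -
  have grad: "grad u = g"
    using u by (auto intro: grad_eqI)
  let ?N = "norm (g x)"
  have N: "?N \<noteq> 0"
    using ne by simp
  have "((\<lambda>y. norm (g y)) has_derivative (\<lambda>h. (M *v h) \<bullet> sgn (g x))) (at x)"
    by (rule has_derivative_compose[OF g has_derivative_norm[OF ne]])
  from has_derivative_scaleR[OF Deriv.has_derivative_inverse[OF _ this] g]
  have "((\<lambda>y. g y /\<^sub>R norm (g y)) has_derivative
      (\<lambda>h. inverse ?N *\<^sub>R (M *v h) + (- (inverse ?N * ((M *v h) \<bullet> sgn (g x)) * inverse ?N)) *\<^sub>R g x)) (at x)"
    using N by simp
  then have fd: "frechet_derivative (\<lambda>y. g y /\<^sub>R norm (g y)) (at x) =
      (\<lambda>h. inverse ?N *\<^sub>R (M *v h) + (- (inverse ?N * ((M *v h) \<bullet> sgn (g x)) * inverse ?N)) *\<^sub>R g x)"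
    by (rule frechet_derivative_at[symmetric])
  have N2: "?N\<^sup>2 = (g x $ 1)\<^sup>2 + (g x $ 2)\<^sup>2"
    by (simp add: power2_norm_eq_inner inner_vec_def sum_2 power2_eq_square[of "_ $ _"])
  have curv: "curv u x = - (M$1$1 + M$2$2) / ?N +
      (g x $ 1 * (M$1$1 * g x $ 1 + M$2$1 * g x $ 2) + g x $ 2 * (M$1$2 * g x $ 1 + M$2$2 * g x $ 2)) / (?N * ?N\<^sup>2)"
    unfolding curv_def grad divergence_def fd
    using N
    by (simp add: sum_2 matrix_vector_mult_basis column_def inner_vec_def sgn_div_norm
        field_simps power2_eq_square)
  have "?N\<^sup>2 * (?N * curv u x) = - ?N\<^sup>2 * (M$1$1 + M$2$2) +
      (g x $ 1 * (M$1$1 * g x $ 1 + M$2$1 * g x $ 2) + g x $ 2 * (M$1$2 * g x $ 1 + M$2$2 * g x $ 2))"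
    unfolding curv using N by (simp add: field_simps power2_eq_square)
  also have "\<dots> = - (perp (g x) \<bullet> (M *v perp (g x)))"
    unfolding N2 quadratic_form_2 by (simp add: perp_def power2_eq_square algebra_simps)
  also have "\<dots> = ?N\<^sup>2 * - (v \<bullet> (M *v v))"
    using tangent_quadratic_form[OF v, of M] by simp
  finally show ?thesis
    using N by (subst (asm) mult_cancel_left) simp
qed

section \<open>Second-order jets of space-time functions\<close>

text \<open>The part of a second-order Taylor expansion that the argument uses: \<open>g\<close> is the spatial gradient,
  \<open>\<tau>\<close> the time derivative and \<open>H\<close> the spatial Hessian. Keeping them as explicit data lets the penalized
  test function be handled without iterated \<^const>\<open>frechet_derivative\<close>s.\<close>

definition jet_on ::
    "((real^2) \<times> real \<Rightarrow> real) \<Rightarrow> ((real^2) \<times> real \<Rightarrow> real^2) \<Rightarrow> ((real^2) \<times> real \<Rightarrow> real) \<Rightarrow>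
     ((real^2) \<times> real \<Rightarrow> real^2^2) \<Rightarrow> ((real^2) \<times> real) set \<Rightarrow> bool" where
  "jet_on \<psi> g \<tau> H S \<longleftrightarrow>
     (\<forall>Y\<in>S. (\<psi> has_derivative (\<lambda>(p, r). p \<bullet> g Y + r * \<tau> Y)) (at Y)) \<and>
     (\<forall>Y\<in>S. ((\<lambda>y. g (y, snd Y)) has_derivative (*v) (H Y)) (at (fst Y))) \<and>
     continuous_on S g \<and> continuous_on S \<tau> \<and> continuous_on S H"

lemma linear_space_time:
  fixes F :: "(real^2) \<times> real \<Rightarrow> real"
  assumes "linear F"
  shows "F (p, r) = p $ 1 * F (axis 1 1, 0) + p $ 2 * F (axis 2 1, 0) + r * F (0, 1)"
proof -
  have "(p, r) = p $ 1 *\<^sub>R (axis 1 1, 0) + p $ 2 *\<^sub>R (axis 2 1, 0) + r *\<^sub>R (0, 1)"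
    by (simp add: vec_eq_iff forall_2 axis_def)
  then show ?thesis
    by (simp only: linear_add[OF assms] linear_scale[OF assms] real_scaleR_def)
qed

lemma has_derivative_vec_lambda:
  fixes f :: "'a::euclidean_space \<Rightarrow> 'n::finite \<Rightarrow> real"
  assumes "\<And>i. ((\<lambda>x. f x i) has_derivative (\<lambda>h. f' h i)) (at a)"
  shows "((\<lambda>x. \<chi> i. f x i) has_derivative (\<lambda>h. \<chi> i. f' h i)) (at a)"
  using assms by (subst has_derivative_componentwise_within) (auto simp: Basis_vec_def inner_axis)

lemma smooth_imp_jet:
  assumes "smooth_on \<phi> S" "open S"
  obtains g \<tau> H where "jet_on \<phi> g \<tau> H S"
proof -
  define D where "D w Y = frechet_derivative \<phi> (at Y) w" for w Y
  define DD where "DD w z Y = frechet_derivative (D w) (at Y) z" for w z Y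
  have C2: "Ck_on (Suc (Suc 0)) \<phi> S"
    using assms(1) unfolding smooth_on_def by blast
  have dphi: "(\<phi> has_derivative (\<lambda>w. D w Y)) (at Y)" if "Y \<in> S" for Y
    using C2 that unfolding D_def by (simp add: frechet_derivative_works[symmetric])
  have C1: "Ck_on (Suc 0) (D w) S" for w
    using C2 Ck_on.simps(2)[of "Suc 0" \<phi> S] unfolding D_def[abs_def] by blast
  then have dD: "(D w has_derivative (\<lambda>z. DD w z Y)) (at Y)" if "Y \<in> S" for Y w
    using C1[of w] that unfolding DD_def by (simp add: frechet_derivative_works[symmetric])
  have cDD: "continuous_on S (DD w z)" for w z
    using C1[of w] Ck_on.simps(2)[of 0 "D w" S] unfolding DD_def[abs_def] Ck_on.simps(1) by blast
  have cD: "continuous_on S (D w)" for w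
    using has_derivative_continuous[OF dD] by (simp add: continuous_on_eq_continuous_at[OF assms(2)])
  define g where "g Y = (\<chi> i. D (axis i 1, 0) Y)" for Y
  define H where "H Y = (\<chi> i j. DD (axis i 1, 0) (axis j 1, 0) Y)" for Y
  have "(\<phi> has_derivative (\<lambda>(p, r). p \<bullet> g Y + r * D (0, 1) Y)) (at Y)" if "Y \<in> S" for Y
  proof -
    have "D (p, r) Y = p \<bullet> g Y + r * D (0, 1) Y" for p r
      unfolding linear_space_time[OF has_derivative_linear[OF dphi[OF that]], of p r]
      by (simp add: g_def inner_vec_def sum_2)
    from this[of "fst w" "snd w" for w]
    have "(\<lambda>w. D w Y) = (\<lambda>(p, r). p \<bullet> g Y + r * D (0, 1) Y)"
      unfolding case_prod_beta prod.collapse by (rule ext)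
    with dphi[OF that] show ?thesis
      by metis
  qed
  moreover have "((\<lambda>y. g (y, snd Y)) has_derivative (*v) (H Y)) (at (fst Y))" if "Y \<in> S" for Y
  proof -
    have "((\<lambda>y. D w (y, snd Y)) has_derivative (\<lambda>p. DD w (p, 0) Y)) (at (fst Y))" for w
      by (rule has_derivative_compose[where g = "D w" and f = "\<lambda>y. (y, snd Y)" and g' = "\<lambda>z. DD w z Y"])
        (use dD[OF that, of w] in \<open>auto intro!: derivative_eq_intros\<close>)
    moreover have "DD w (p, 0) Y = p $ 1 * DD w (axis 1 1, 0) Y + p $ 2 * DD w (axis 2 1, 0) Y" for w p
      using linear_space_time[OF has_derivative_linear[OF dD[OF that]], of w p 0] by simp
    ultimately have "((\<lambda>y. D w (y, snd Y)) has_derivative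
        (\<lambda>p. p $ 1 * DD w (axis 1 1, 0) Y + p $ 2 * DD w (axis 2 1, 0) Y)) (at (fst Y))" for w
      by (rule has_derivative_eq_rhs[OF _ ext])
    then have "((\<lambda>y. \<chi> i. D (axis i 1, 0) (y, snd Y)) has_derivative
        (\<lambda>p. \<chi> i. p $ 1 * DD (axis i 1, 0) (axis 1 1, 0) Y + p $ 2 * DD (axis i 1, 0) (axis 2 1, 0) Y))
        (at (fst Y))"
      by (rule has_derivative_vec_lambda)
    moreover have "(*v) (H Y) =
        (\<lambda>p. \<chi> i. p $ 1 * DD (axis i 1, 0) (axis 1 1, 0) Y + p $ 2 * DD (axis i 1, 0) (axis 2 1, 0) Y)"
      by (auto simp: fun_eq_iff vec_eq_iff H_def matrix_vector_mult_def sum_2 mult.commute)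
    ultimately show ?thesis
      by (simp add: g_def)
  qed
  moreover have "continuous_on S g" "continuous_on S H"
    unfolding g_def H_def by (intro continuous_on_vec_lambda cD cDD)+
  ultimately have "jet_on \<phi> g (D (0, 1)) H S"
    unfolding jet_on_def using cD by blast
  then show thesis
    by (rule that)
qed

lemma jet_on_add_square_distance:
  assumes "jet_on \<phi> g \<tau> H S"
  shows "jet_on (\<lambda>Y. \<phi> Y + d * (dist Y X)\<^sup>2) (\<lambda>Y. g Y + (2 * d) *\<^sub>R (fst Y - fst X))
    (\<lambda>Y. \<tau> Y + 2 * d * (snd Y - snd X)) (\<lambda>Y. H Y + (2 * d) *\<^sub>R mat 1) S"
proof -
  have sq: "(dist Y X)\<^sup>2 = (fst Y - fst X) \<bullet> (fst Y - fst X) + (snd Y - snd X)\<^sup>2" for Y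
    by (simp add: dist_prod_def dist_norm power2_norm_eq_inner)
  have "((\<lambda>Y. \<phi> Y + d * (dist Y X)\<^sup>2) has_derivative
      (\<lambda>(p, r). p \<bullet> (g Y + (2 * d) *\<^sub>R (fst Y - fst X)) + r * (\<tau> Y + 2 * d * (snd Y - snd X)))) (at Y)"
    if "Y \<in> S" for Y
  proof -
    have "(\<phi> has_derivative (\<lambda>(p, r). p \<bullet> g Y + r * \<tau> Y)) (at Y)"
      using assms that unfolding jet_on_def by blast
    then show ?thesis
      unfolding sq case_prod_beta
      by (auto intro!: derivative_eq_intros simp: algebra_simps inner_simps inner_commute)
  qed
  moreover have "((\<lambda>y. g (y, snd Y) + (2 * d) *\<^sub>R (y - fst X)) has_derivative
      (*v) (H Y + (2 * d) *\<^sub>R mat 1)) (at (fst Y))" if "Y \<in> S" for Y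
  proof -
    have "((\<lambda>y. g (y, snd Y)) has_derivative (*v) (H Y)) (at (fst Y))"
      using assms that unfolding jet_on_def by blast
    then show ?thesis
      by (auto intro!: derivative_eq_intros
          simp: matrix_vector_mult_add_rdistrib scaleR_matrix_vector_assoc[symmetric])
  qed
  ultimately show ?thesis
    using assms unfolding jet_on_def by (auto intro!: continuous_intros)
qed

section \<open>Change of the test function in one move of the game\<close>

text \<open>The displacement of a move is split according to its order in \<open>\<epsilon>\<close>. The part of order \<open>\<epsilon>\<close> is tangential,
  so the first-order term vanishes and the second-order term contributes at scale \<open>\<epsilon>\<^sup>2\<close>; for the rest,
  which is of size \<open>\<epsilon>\<^sup>2\<close>, the first order suffices. Two mean value theorems give this with the derivatives
  evaluated at nearby points \<open>Y\<close> and \<open>Y'\<close>, and so without any rate for the error. Only these points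
  depend on the signs \<open>b\<close> and \<open>\<beta>\<close> that the opponent chooses, not the form of the bound.\<close>

lemma move_expansion:
  fixes x v :: "real^2" and T :: real
  assumes jet: "jet_on \<psi> g \<tau> H (UNIV \<times> {0<..<T})"
    and t: "0 < t" "t + \<epsilon>\<^sup>2 < T" and \<epsilon>: "0 < \<epsilon>" and s: "0 < s" and F: "0 \<le> F"
    and v: "norm v = 1" "v \<bullet> g (x, t) = 0"
    and b: "\<bar>b\<bar> = 1" and \<beta>: "\<bar>\<beta>\<bar> = 1"
  obtains Y Y' where "dist Y (x, t) \<le> \<epsilon> * s" "dist Y' (x, t) \<le> \<epsilon> * s + \<epsilon>\<^sup>2 * (F + 1)"
    "\<psi> (x + (b * \<epsilon> * s) *\<^sub>R v + (\<beta> * \<epsilon>\<^sup>2 * F) *\<^sub>R perp v, t + \<epsilon>\<^sup>2) - \<psi> (x, t)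
      \<le> \<epsilon>\<^sup>2 * (s\<^sup>2 / 2 * (v \<bullet> (H Y *v v)) + F * norm (g Y') + \<tau> Y')"
proof -
  have d\<psi>: "(\<psi> has_derivative (\<lambda>(p, r). p \<bullet> g Y + r * \<tau> Y)) (at Y)"
    and dg: "((\<lambda>y. g (y, snd Y)) has_derivative (*v) (H Y)) (at (fst Y))" if "snd Y \<in> {0<..<T}" for Y
    using jet that unfolding jet_on_def by (cases Y; force)+
  have tT: "t \<in> {0<..<T}"
    using t zero_le_power2[of \<epsilon>] unfolding greaterThanLessThan_iff by linarith
  let ?l = "\<lambda>r. x + r *\<^sub>R v"
  let ?a = "b * \<epsilon> * s"
  have a: "\<bar>?a\<bar> = \<epsilon> * s"
    using b \<epsilon> s by (simp add: abs_mult)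
  (* The function below and its first two derivatives along the tangential line, in the form
     that Maclaurin's formula expects. *)
  define h where "h = (\<lambda>m::nat. if m = 0 then (\<lambda>r. \<psi> (?l r, t))
    else if m = 1 then (\<lambda>r. v \<bullet> g (?l r, t)) else (\<lambda>r. v \<bullet> (H (?l r, t) *v v)))"
  have h1: "DERIV (\<lambda>r. \<psi> (?l r, t)) r :> v \<bullet> g (?l r, t)" for r
  proof -
    have "((\<lambda>r. \<psi> (?l r, t)) has_derivative (\<lambda>h. (\<lambda>(p, r'). p \<bullet> g (?l r, t) + r' * \<tau> (?l r, t)) (h *\<^sub>R v, 0))) (at r)"
      by (rule has_derivative_compose[where f = "\<lambda>r. (?l r, t)" and g = \<psi>])
        (use d\<psi>[of "(?l r, t)"] tT in \<open>auto intro!: derivative_eq_intros\<close>)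
    then show ?thesis
      by (simp add: has_field_derivative_def mult_commute_abs)
  qed
  have h2: "DERIV (\<lambda>r. v \<bullet> g (?l r, t)) r :> v \<bullet> (H (?l r, t) *v v)" for r
  proof -
    have "((\<lambda>r. g (?l r, t)) has_derivative (\<lambda>h. H (?l r, t) *v (h *\<^sub>R v))) (at r)"
      by (rule has_derivative_compose[where f = ?l and g = "\<lambda>y. g (y, t)"])
        (use dg[of "(?l r, t)"] tT in \<open>auto intro!: derivative_eq_intros\<close>)
    from has_derivative_inner_right[OF this, of v] show ?thesis
      by (simp add: has_field_derivative_def matrix_vector_mult_scaleR mult_commute_abs)
  qed
  have "\<exists>r. \<bar>r\<bar> \<le> \<bar>?a\<bar> \<and> \<psi> (?l ?a, t) = (\<Sum>m<2. h m 0 / fact m * ?a ^ m) + h 2 r / fact 2 * ?a ^ 2"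
  proof (rule Maclaurin_bi_le)
    show "\<forall>m r. m < 2 \<and> \<bar>r\<bar> \<le> \<bar>?a\<bar> \<longrightarrow> DERIV (h m) r :> h (Suc m) r"
      using h1 h2 by (auto simp: h_def less_2_cases_iff)
  qed (simp add: h_def)
  then obtain r where r: "\<bar>r\<bar> \<le> \<epsilon> * s"
    and E1: "\<psi> (?l ?a, t) = \<psi> (x, t) + v \<bullet> (H (?l r, t) *v v) / 2 * ?a\<^sup>2"
    using v(2) unfolding a by (auto simp: h_def numeral_2_eq_2)
  have a2: "?a\<^sup>2 = \<epsilon>\<^sup>2 * s\<^sup>2"
    using a by (metis power2_abs power_mult_distrib)
  (* The rest of the move is a straight segment in space-time, parametrized by elapsed time. *)
  let ?w = "\<lambda>\<theta>. (?l ?a + (\<theta> * (\<beta> * F)) *\<^sub>R perp v, t + \<theta>)"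
  have h3: "DERIV (\<lambda>\<theta>. \<psi> (?w \<theta>)) \<theta> :> (\<beta> * F) * (perp v \<bullet> g (?w \<theta>)) + \<tau> (?w \<theta>)" if "0 \<le> \<theta>" "\<theta> \<le> \<epsilon>\<^sup>2" for \<theta>
  proof -
    have "((\<lambda>\<theta>. \<psi> (?w \<theta>)) has_derivative
        (\<lambda>h. (\<lambda>(p, r'). p \<bullet> g (?w \<theta>) + r' * \<tau> (?w \<theta>)) ((h * (\<beta> * F)) *\<^sub>R perp v, h))) (at \<theta>)"
      by (rule has_derivative_compose[where f = ?w and g = \<psi>])
        (use d\<psi>[of "?w \<theta>"] t that in \<open>auto intro!: derivative_eq_intros\<close>)
    then show ?thesis
      unfolding has_field_derivative_def by (rule has_derivative_eq_rhs) (simp add: fun_eq_iff algebra_simps)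
  qed
  have "0 < \<epsilon>\<^sup>2"
    using \<epsilon> by simp
  from MVT2[OF this h3] obtain \<theta> where \<theta>: "0 < \<theta>" "\<theta> < \<epsilon>\<^sup>2"
    and E2: "\<psi> (?w (\<epsilon>\<^sup>2)) - \<psi> (?w 0) = \<epsilon>\<^sup>2 * ((\<beta> * F) * (perp v \<bullet> g (?w \<theta>)) + \<tau> (?w \<theta>))"
    by auto
  have "(\<beta> * F) * (perp v \<bullet> g (?w \<theta>)) \<le> F * norm (g (?w \<theta>))"
  proof -
    have "\<bar>perp v \<bullet> g (?w \<theta>)\<bar> \<le> norm (g (?w \<theta>))"
      using Cauchy_Schwarz_ineq2[of "perp v" "g (?w \<theta>)"] v(1) by (simp add: norm_perp)
    then have "\<bar>(\<beta> * F) * (perp v \<bullet> g (?w \<theta>))\<bar> \<le> F * norm (g (?w \<theta>))"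
      using \<beta> F by (simp add: abs_mult mult_left_mono)
    then show ?thesis
      by linarith
  qed
  then have "\<epsilon>\<^sup>2 * ((\<beta> * F) * (perp v \<bullet> g (?w \<theta>)) + \<tau> (?w \<theta>)) \<le> \<epsilon>\<^sup>2 * (F * norm (g (?w \<theta>)) + \<tau> (?w \<theta>))"
    by (intro mult_left_mono) auto
  then have "\<psi> (x + ?a *\<^sub>R v + (\<beta> * \<epsilon>\<^sup>2 * F) *\<^sub>R perp v, t + \<epsilon>\<^sup>2) - \<psi> (x, t)
      \<le> \<epsilon>\<^sup>2 * (s\<^sup>2 / 2 * (v \<bullet> (H (?l r, t) *v v)) + F * norm (g (?w \<theta>)) + \<tau> (?w \<theta>))"
    using E1 E2 unfolding a2 by (simp add: algebra_simps)
  moreover have "dist (?l r, t) (x, t) \<le> \<epsilon> * s"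
    using r v(1) by (simp add: dist_Pair_Pair dist_norm)
  moreover have "dist (?w \<theta>) (x, t) \<le> \<epsilon> * s + \<epsilon>\<^sup>2 * (F + 1)"
  proof -
    have "dist (?w \<theta>) (x, t) \<le> norm (?a *\<^sub>R v + (\<theta> * (\<beta> * F)) *\<^sub>R perp v) + norm \<theta>"
      using norm_Pair_le[of "?a *\<^sub>R v + (\<theta> * (\<beta> * F)) *\<^sub>R perp v" \<theta>] by (simp add: dist_norm add.assoc)
    also have "norm (?a *\<^sub>R v + (\<theta> * (\<beta> * F)) *\<^sub>R perp v) \<le> \<epsilon> * s + \<theta> * F"
      by (rule order.trans[OF norm_triangle_ineq])
        (use a v(1) \<beta> F \<theta> in \<open>simp add: norm_perp abs_mult\<close>)
    also have "\<epsilon> * s + \<theta> * F + norm \<theta> \<le> \<epsilon> * s + \<epsilon>\<^sup>2 * (F + 1)"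
      using mult_right_mono[OF less_imp_le[OF \<theta>(2)] F] \<theta> by (simp add: algebra_simps)
    finally show ?thesis
      by simp
  qed
  ultimately show thesis
    using that by blast
qed

text \<open>If moves that start at points converging to \<open>X\<close> decrease \<open>\<psi>\<close> by at most \<open>\<epsilon>\<^sup>3\<close>, then dividing the
  expansion by \<open>\<epsilon>\<^sup>2\<close> and passing to the limit shows that the drift at \<open>X\<close> is nonnegative.\<close>

lemma move_limit:
  fixes v :: "nat \<Rightarrow> real^2" and T :: real
  assumes jet: "jet_on \<psi> g \<tau> H (UNIV \<times> {0<..<T})"
    and X: "snd X \<in> {0<..<T}"
    and Z: "Z \<longlonglongrightarrow> X" and e: "e \<longlonglongrightarrow> 0" "\<And>n. 0 < e n" and s: "0 < s" and F: "0 \<le> F"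
    and v: "\<And>n. norm (v n) = 1" "\<And>n. v n \<bullet> g (Z n) = 0" "v \<longlonglongrightarrow> w"
    and b: "\<And>n. \<bar>b n\<bar> = 1" and \<beta>: "\<And>n. \<bar>\<beta> n\<bar> = 1"
    and almost_max: "\<forall>\<^sub>F n in sequentially. \<psi> (Z n) - e n ^ 3 \<le>
      \<psi> (fst (Z n) + (b n * e n * s) *\<^sub>R v n + (\<beta> n * (e n)\<^sup>2 * F) *\<^sub>R perp (v n), snd (Z n) + (e n)\<^sup>2)"
  shows "0 \<le> s\<^sup>2 / 2 * (w \<bullet> (H X *v w)) + F * norm (g X) + \<tau> X"
proof -
  have Zt: "(\<lambda>n. snd (Z n)) \<longlonglongrightarrow> snd X" "(\<lambda>n. snd (Z n) + (e n)\<^sup>2) \<longlonglongrightarrow> snd X + 0\<^sup>2"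
    by (intro tendsto_intros Z e(1))+
  have "\<forall>\<^sub>F n in sequentially. 0 < snd (Z n)" "\<forall>\<^sub>F n in sequentially. snd (Z n) + (e n)\<^sup>2 < T"
    using X order_tendstoD(1)[OF Zt(1)] order_tendstoD(2)[OF Zt(2)] by auto
  with almost_max have "\<forall>\<^sub>F n in sequentially. \<exists>Y Y'. dist Y (Z n) \<le> e n * s \<and>
      dist Y' (Z n) \<le> e n * s + (e n)\<^sup>2 * (F + 1) \<and>
      - e n \<le> s\<^sup>2 / 2 * (v n \<bullet> (H Y *v v n)) + F * norm (g Y') + \<tau> Y'"
  proof eventually_elim
    case (elim n)
    obtain Y Y' where Y: "dist Y (Z n) \<le> e n * s" "dist Y' (Z n) \<le> e n * s + (e n)\<^sup>2 * (F + 1)"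
      and le: "\<psi> (fst (Z n) + (b n * e n * s) *\<^sub>R v n + (\<beta> n * (e n)\<^sup>2 * F) *\<^sub>R perp (v n), snd (Z n) + (e n)\<^sup>2)
          - \<psi> (Z n) \<le> (e n)\<^sup>2 * (s\<^sup>2 / 2 * (v n \<bullet> (H Y *v v n)) + F * norm (g Y') + \<tau> Y')"
      using move_expansion[OF jet elim(2,3) e(2) s F v(1)[of n] _ b[of n] \<beta>[of n], of "fst (Z n)"] v(2)[of n]
      unfolding prod.collapse by blast
    have "(e n)\<^sup>2 * - e n \<le> (e n)\<^sup>2 * (s\<^sup>2 / 2 * (v n \<bullet> (H Y *v v n)) + F * norm (g Y') + \<tau> Y')"
      using le elim(1) by (simp add: power2_eq_square power3_eq_cube)
    then have "- e n \<le> s\<^sup>2 / 2 * (v n \<bullet> (H Y *v v n)) + F * norm (g Y') + \<tau> Y'"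
      by (rule mult_left_le_imp_le) (use e(2)[of n] in simp)
    with Y show ?case
      by blast
  qed
  then obtain Y Y' where
    YY: "\<forall>\<^sub>F n in sequentially. dist (Y n) (Z n) \<le> e n * s \<and>
      dist (Y' n) (Z n) \<le> e n * s + (e n)\<^sup>2 * (F + 1) \<and>
      - e n \<le> s\<^sup>2 / 2 * (v n \<bullet> (H (Y n) *v v n)) + F * norm (g (Y' n)) + \<tau> (Y' n)"
    unfolding eventually_ex by blast
  have close: "U \<longlonglongrightarrow> X" if "\<forall>\<^sub>F n in sequentially. dist (U n) (Z n) \<le> c n" "c \<longlonglongrightarrow> 0" for U c
  proof -
    have "(\<lambda>n. dist (U n) (Z n)) \<longlonglongrightarrow> 0"
      by (rule tendsto_sandwich[OF _ that(1) tendsto_const that(2)]) simp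
    then have "(\<lambda>n. U n - Z n) \<longlonglongrightarrow> 0"
      unfolding dist_norm by (rule tendsto_norm_zero_cancel)
    from tendsto_add[OF this Z] show ?thesis
      by simp
  qed
  have c: "(\<lambda>n. e n * s) \<longlonglongrightarrow> 0" "(\<lambda>n. e n * s + (e n)\<^sup>2 * (F + 1)) \<longlonglongrightarrow> 0"
    by (rule tendsto_eq_intros e(1) refl | simp)+
  have Y: "Y \<longlonglongrightarrow> X"
    by (rule close[OF eventually_mono[OF YY] c(1)]) blast
  have Y': "Y' \<longlonglongrightarrow> X"
    by (rule close[OF eventually_mono[OF YY] c(2)]) blast
  have open_strip: "open (UNIV \<times> {0<..<T} :: ((real^2) \<times> real) set)"
    by (intro open_Times) auto
  have XS: "X \<in> UNIV \<times> {0<..<T}"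
    using X by (cases X) auto
  have cont: "isCont g X" "isCont \<tau> X" "isCont H X"
    using jet XS open_strip unfolding jet_on_def by (auto simp: continuous_on_eq_continuous_at)
  have lim: "(\<lambda>n. s\<^sup>2 / 2 * (v n \<bullet> (H (Y n) *v v n)) + F * norm (g (Y' n)) + \<tau> (Y' n))
      \<longlonglongrightarrow> s\<^sup>2 / 2 * (w \<bullet> (H X *v w)) + F * norm (g X) + \<tau> X"
    unfolding quadratic_form_2
    by (intro tendsto_intros v(3) isCont_tendsto_compose[OF cont(1) Y']
        isCont_tendsto_compose[OF cont(2) Y'] isCont_tendsto_compose[OF cont(3) Y])
  have "(\<lambda>n. - e n) \<longlonglongrightarrow> - 0"
    by (intro tendsto_minus e(1))
  from tendsto_le[OF sequentially_bot lim this] eventually_mono[OF YY] show ?thesis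
    by simp
qed

section \<open>A strategy where the subsolution inequality fails\<close>

lemma quadratic_form_le_onorm:
  fixes v :: "real^2" and M :: "real^2^2"
  assumes "norm v = 1"
  shows "v \<bullet> (M *v v) \<le> onorm ((*v) M)"
  using Cauchy_Schwarz_ineq2[of v "M *v v"] onorm[OF matrix_vector_mul_bounded_linear, of M v] assms
  by simp

text \<open>Where the subsolution inequality fails strictly, the minimizing player has a step size, fixed once and
  for all, that makes the drift negative against every move of the opponent. For negative curvature it
  is the optimal one, and the drift is then the left-hand side of the equation. For nonnegative
  curvature tangential steps do not increase the test function to second order, so a step so large that
  the cost is negligible works. At a critical point the normal displacement has no first-order effect, so a
  step so small that the second derivatives are negligible works. The bound \<open>m\<close> is uniform in the direction
  \<open>w\<close>, which leaves room for a penalization chosen before \<open>w\<close> is known.\<close>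

lemma step_size_with_negative_drift:
  fixes g :: "real^2 \<Rightarrow> real^2" and M :: "real^2^2"
  assumes \<gamma>: "0 < \<gamma>" "\<gamma> < 1"
    and u: "\<And>y. GDERIV u y :> g y" and g: "(g has_derivative (*v) M) (at x)"
    and strict: "if g x \<noteq> 0 then \<tau> - norm (g x) * varphi \<gamma> (curv u x) < 0 else \<tau> < 0"
  obtains s m where "0 < s" "m < 0"
    "\<And>w. norm w = 1 \<Longrightarrow> w \<bullet> g x = 0 \<Longrightarrow>
       s\<^sup>2 / 2 * (w \<bullet> (M *v w)) + f_gam \<gamma> s * norm (g x) + \<tau> \<le> m"
proof (cases "g x = 0")
  case True
  with strict have \<tau>: "\<tau> < 0"
    by simp
  define K where "K = onorm ((*v) M)"
  have K: "0 \<le> K"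
    unfolding K_def by (rule onorm_pos_le) simp
  define s where "s = sqrt (- \<tau> / (K + 1))"
  have s2: "s\<^sup>2 = - \<tau> / (K + 1)" and s: "0 < s"
    using \<tau> K by (simp_all add: s_def divide_neg_pos less_imp_le)
  show thesis
  proof (rule that[OF s, of "\<tau> / 2"])
    fix w :: "real^2" assume w: "norm w = 1" "w \<bullet> g x = 0"
    have "s\<^sup>2 / 2 * (w \<bullet> (M *v w)) \<le> s\<^sup>2 / 2 * (K + 1)"
      using quadratic_form_le_onorm[OF w(1), of M] by (intro mult_left_mono) (auto simp: K_def)
    also have "\<dots> = - \<tau> / 2"
      unfolding s2 using K by (simp add: field_simps)
    finally show "s\<^sup>2 / 2 * (w \<bullet> (M *v w)) + f_gam \<gamma> s * norm (g x) + \<tau> \<le> \<tau> / 2"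
      using True by simp
  qed (use \<tau> in simp)
next
  case False
  define \<kappa> where "\<kappa> = curv u x"
  have Q: "w \<bullet> (M *v w) = - norm (g x) * \<kappa>" if "norm w = 1" "w \<bullet> g x = 0" for w
    using curv_eq_tangential_second_derivative[OF u g False that] by (simp add: \<kappa>_def)
  have strict': "\<tau> < norm (g x) * varphi \<gamma> \<kappa>"
    using strict False by (simp add: \<kappa>_def)
  have "\<exists>s>0. norm (g x) * (f_gam \<gamma> s + s\<^sup>2 * - \<kappa> / 2) + \<tau> < 0"
  proof (cases "\<kappa> < 0")
    case True
    have "f_gam \<gamma> (sqrt (2 * \<gamma> * (- \<kappa>) powr (\<gamma> - 1))) + (sqrt (2 * \<gamma> * (- \<kappa>) powr (\<gamma> - 1)))\<^sup>2 * - \<kappa> / 2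
        = (- \<kappa>) powr \<gamma>"
      by (rule f_gam_optimal_step) (use \<gamma> True in auto)
    moreover have "norm (g x) * (- \<kappa>) powr \<gamma> + \<tau> < 0"
      using strict' True by (simp add: varphi_def)
    moreover have "0 < sqrt (2 * \<gamma> * (- \<kappa>) powr (\<gamma> - 1))"
      using \<gamma> True by simp
    ultimately show ?thesis
      by metis
  next
    case nonneg: False
    then have \<tau>: "\<tau> < 0"
      using strict' by (auto simp: varphi_def split: if_splits)
    have "((\<lambda>s. norm (g x) * f_gam \<gamma> s) \<longlongrightarrow> 0) at_top"
      by (intro tendsto_mult_right_zero f_gam_tendsto_0 \<gamma>)
    then have "\<forall>\<^sub>F s in at_top. norm (g x) * f_gam \<gamma> s < - \<tau>"
      using \<tau> by (auto intro: order_tendstoD(2))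
    with eventually_gt_at_top[of 0] have "\<forall>\<^sub>F s in at_top. 0 < s \<and> norm (g x) * f_gam \<gamma> s < - \<tau>"
      by (rule eventually_conj)
    from eventually_happens'[OF trivial_limit_at_top_linorder this]
    obtain s where s: "0 < s" "norm (g x) * f_gam \<gamma> s < - \<tau>"
      by blast
    moreover have "0 \<le> norm (g x) * (s\<^sup>2 * \<kappa> / 2)"
      using nonneg by simp
    ultimately show ?thesis
      by (intro exI[of _ s]) (simp add: algebra_simps)
  qed
  then obtain s where s: "0 < s" "norm (g x) * (f_gam \<gamma> s + s\<^sup>2 * - \<kappa> / 2) + \<tau> < 0"
    by blast
  show thesis
    by (rule that[OF s]) (simp add: Q algebra_simps)
qed

lemma ex_unit_tangent: "\<exists>v::real^2. norm v = 1 \<and> v \<bullet> g = 0"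
proof (cases "g = 0")
  case True
  then show ?thesis
    by (intro exI[of _ "axis 1 1"]) simp
next
  case False
  then show ?thesis
    using inner_perp[of g]
    by (intro exI[of _ "perp g /\<^sub>R norm g"]) (simp add: norm_perp inner_commute)
qed

section \<open>Near-maximizers of the value functions\<close>

text \<open>Take nearly optimal points of \<open>w \<epsilon> - \<psi>\<close> over \<open>K\<close> along a sequence that realizes the relaxed limit at
  \<open>X\<close>. A limit point of them has, by the definition of the relaxed limit, a value of \<open>u - \<psi>\<close> at least as
  large as \<open>X\<close> has, so strictness of the maximum forces it to be \<open>X\<close>. Near-maximality up to \<open>\<epsilon>\<^sup>3\<close> suffices
  for a comparison at scale \<open>\<epsilon>\<^sup>2\<close>.\<close>

lemma near_maximizers_tendsto:
  fixes X :: "'a::metric_space" and \<psi> :: "'a \<Rightarrow> real"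
  assumes K: "compact K" "X \<in> interior K" and \<psi>: "continuous_on K \<psi>"
    and u: "\<And>Y. Y \<in> K \<Longrightarrow> upper_half_relaxed_limit D w Y = ereal (u Y)"
    and strict_max: "\<And>Y. Y \<in> K \<Longrightarrow> u X - \<psi> X \<le> u Y - \<psi> Y \<Longrightarrow> Y = X"
    and bound: "\<And>\<epsilon> Y. 0 < \<epsilon> \<Longrightarrow> \<epsilon> < 1 \<Longrightarrow> w \<epsilon> Y \<le> C"
  obtains Z e where "Z \<longlonglongrightarrow> X" "e \<longlonglongrightarrow> 0" "\<And>n. 0 < e n" "\<And>n. e n < 1"
    "\<And>n. Z n \<in> K" "\<And>n. Z n \<in> D (e n)"
    "\<And>n Z'. Z' \<in> K \<Longrightarrow> Z' \<in> D (e n) \<Longrightarrow> w (e n) Z' - \<psi> Z' \<le> w (e n) (Z n) - \<psi> (Z n) + e n ^ 3"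
proof -
  have XK: "X \<in> K"
    using K(2) interior_subset by blast
  obtain Y0 e0 where Y0: "Y0 \<longlonglongrightarrow> X" "e0 \<longlonglongrightarrow> 0" "\<And>n. 0 < e0 n" "\<And>n. e0 n < 1" "\<And>n. Y0 n \<in> D (e0 n)"
    "\<And>n. u X - 1 / real (Suc n) < w (e0 n) (Y0 n)"
    using upper_half_relaxed_limit_realizing_sequence[OF u[OF XK]] by blast
  have "\<forall>\<^sub>F n in sequentially. Y0 n \<in> interior K"
    by (rule topological_tendstoD[OF Y0(1)]) (use K in auto)
  then obtain N where N: "\<And>n. N \<le> n \<Longrightarrow> Y0 n \<in> K"
    unfolding eventually_sequentially using interior_subset by blast
  obtain B where B: "\<And>Y. Y \<in> K \<Longrightarrow> \<bar>\<psi> Y\<bar> \<le> B"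
    using compact_imp_bounded[OF compact_continuous_image[OF \<psi> K(1)]] unfolding bounded_real
    by blast
  have "\<exists>Z. Z \<in> K \<and> Z \<in> D (e0 n) \<and>
      (\<forall>Z'. Z' \<in> K \<longrightarrow> Z' \<in> D (e0 n) \<longrightarrow> w (e0 n) Z' - \<psi> Z' \<le> w (e0 n) Z - \<psi> Z + e0 n ^ 3)"
    if "N \<le> n" for n
  proof -
    let ?P = "\<lambda>Z. w (e0 n) Z - \<psi> Z" and ?A = "K \<inter> D (e0 n)"
    have ne: "?A \<noteq> {}"
      using N[OF that] Y0(5) by blast
    have bdd: "bdd_above (?P ` ?A)"
    proof (rule bdd_aboveI2)
      fix Z assume "Z \<in> ?A"
      then show "?P Z \<le> C + B"
        using bound[OF Y0(3,4), of n Z] B[of Z] by auto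
    qed
    have "(SUP Z\<in>?A. ?P Z) - e0 n ^ 3 < (SUP Z\<in>?A. ?P Z)"
      using Y0(3)[of n] by simp
    then obtain Z where Z: "Z \<in> ?A" "(SUP Z\<in>?A. ?P Z) - e0 n ^ 3 < ?P Z"
      using less_cSUP_iff[OF ne bdd] by blast
    have "?P Z' \<le> ?P Z + e0 n ^ 3" if "Z' \<in> ?A" for Z'
      using cSUP_upper[OF that bdd] Z(2) by linarith
    with Z(1) show ?thesis
      by blast
  qed
  then obtain Z0 where Z0: "\<And>n. N \<le> n \<Longrightarrow> Z0 n \<in> K" "\<And>n. N \<le> n \<Longrightarrow> Z0 n \<in> D (e0 n)"
    "\<And>n Z'. N \<le> n \<Longrightarrow> Z' \<in> K \<Longrightarrow> Z' \<in> D (e0 n) \<Longrightarrow>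
       w (e0 n) Z' - \<psi> Z' \<le> w (e0 n) (Z0 n) - \<psi> (Z0 n) + e0 n ^ 3"
    by metis
  obtain Zl \<sigma>0 where Zl: "Zl \<in> K" "strict_mono \<sigma>0" "((\<lambda>n. Z0 (n + N)) \<circ> \<sigma>0) \<longlonglongrightarrow> Zl"
    using K(1) Z0(1) unfolding compact_def by (metis le_add2)
  define \<sigma> where "\<sigma> n = \<sigma>0 n + N" for n
  have \<sigma>N: "N \<le> \<sigma> n" for n
    by (simp add: \<sigma>_def)
  have \<sigma>: "strict_mono \<sigma>"
    using Zl(2) by (auto simp: \<sigma>_def strict_mono_def)
  have sub: "(\<lambda>n. h (\<sigma> n)) \<longlonglongrightarrow> l" if "h \<longlonglongrightarrow> l" for h :: "nat \<Rightarrow> 'b::topological_space" and l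
    using LIMSEQ_subseq_LIMSEQ[OF that \<sigma>] by (simp add: o_def)
  have Z: "(\<lambda>n. Z0 (\<sigma> n)) \<longlonglongrightarrow> Zl"
    using Zl(3) by (simp add: \<sigma>_def o_def)
  have Y: "(\<lambda>n. Y0 (\<sigma> n)) \<longlonglongrightarrow> X" and e: "(\<lambda>n. e0 (\<sigma> n)) \<longlonglongrightarrow> 0"
    by (intro sub Y0)+
  have "u X - \<psi> X \<le> u Zl - \<psi> Zl"
  proof (rule ccontr)
    assume "\<not> ?thesis"
    then have "u Zl < u X - \<psi> X + \<psi> Zl"
      by simp
    then obtain a where a: "u Zl < a" "a < u X - \<psi> X + \<psi> Zl"
      using dense by blast
    have "\<forall>\<^sub>F n in sequentially. w (e0 (\<sigma> n)) (Z0 (\<sigma> n)) < a"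
      by (rule upper_half_relaxed_limit_along_sequence[where D = D, OF _ Z e])
        (use u[OF Zl(1)] a(1) Y0(3) Z0(2) \<sigma>N in auto)
    then have "\<forall>\<^sub>F n in sequentially.
        u X - 1 / real (Suc (\<sigma> n)) - \<psi> (Y0 (\<sigma> n)) + \<psi> (Z0 (\<sigma> n)) - e0 (\<sigma> n) ^ 3 \<le> a"
    proof eventually_elim
      case (elim n)
      show ?case
        using elim Y0(6)[of "\<sigma> n"] Z0(3)[OF \<sigma>N N[OF \<sigma>N] Y0(5)[of "\<sigma> n"]] by linarith
    qed
    moreover have "(\<lambda>n. u X - 1 / real (Suc (\<sigma> n)) - \<psi> (Y0 (\<sigma> n)) + \<psi> (Z0 (\<sigma> n)) - e0 (\<sigma> n) ^ 3)
        \<longlonglongrightarrow> u X - 0 - \<psi> X + \<psi> Zl - 0 ^ 3"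
    proof (intro tendsto_intros e)
      show "(\<lambda>n. 1 / real (Suc (\<sigma> n))) \<longlonglongrightarrow> 0"
        using sub[OF LIMSEQ_inverse_real_of_nat] by (simp add: inverse_eq_divide)
      show "(\<lambda>n. \<psi> (Y0 (\<sigma> n))) \<longlonglongrightarrow> \<psi> X"
        by (rule continuous_on_tendsto_compose[OF \<psi> Y XK]) (use N[OF \<sigma>N] in auto)
      show "(\<lambda>n. \<psi> (Z0 (\<sigma> n))) \<longlonglongrightarrow> \<psi> Zl"
        by (rule continuous_on_tendsto_compose[OF \<psi> Z Zl(1)]) (use Z0(1)[OF \<sigma>N] in auto)
    qed
    ultimately have "u X - 0 - \<psi> X + \<psi> Zl - 0 ^ 3 \<le> a"
      by (intro tendsto_upperbound) auto
    with a(2) show False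
      by simp
  qed
  then have "Zl = X"
    using strict_max Zl(1) by blast
  show thesis
    by (rule that[of "\<lambda>n. Z0 (\<sigma> n)" "\<lambda>n. e0 (\<sigma> n)"])
      (use Z e \<open>Zl = X\<close> Y0(3,4) Z0 \<sigma>N in auto)
qed

section \<open>The subsolution property\<close>

text \<open>One step of dynamic programming: the minimizing player may play \<open>(v, s)\<close>, and after the
  opponent's best answer the value cannot be smaller than before, because the value is a minimum over all moves.\<close>

lemma value_fn_le_after_move:
  fixes v :: "real^2"
  assumes e: "0 < \<epsilon>" "\<epsilon> < 1" "0 < \<alpha>1" "0 < \<alpha>2" and u0: "L-lipschitz_on UNIV u0"
    and Z: "Z \<in> game_points T \<epsilon>" "snd Z < T" and v: "norm v = 1" and s: "s \<in> step_range \<alpha>1 \<alpha>2 \<epsilon>"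
  obtains b \<beta> :: real where "\<bar>b\<bar> = 1" "\<bar>\<beta>\<bar> = 1"
    "value_fn \<gamma> \<alpha>1 \<alpha>2 T u0 \<epsilon> Z \<le> value_fn \<gamma> \<alpha>1 \<alpha>2 T u0 \<epsilon>
      (fst Z + (b * \<epsilon> * s) *\<^sub>R v + (\<beta> * \<epsilon>\<^sup>2 * f_gam \<gamma> s) *\<^sub>R perp v, snd Z + \<epsilon>\<^sup>2)"
proof -
  obtain x t where xt: "Z = (x, t)"
    by (cases Z)
  have "value_fn \<gamma> \<alpha>1 \<alpha>2 T u0 \<epsilon> (x, t) \<le>
      payoff \<gamma> \<epsilon> (\<lambda>y. value_fn \<gamma> \<alpha>1 \<alpha>2 T u0 \<epsilon> (y, t + \<epsilon>\<^sup>2)) x v s"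
    using value_fn_attained[OF e u0, of x t T \<gamma>] Z v s unfolding xt by auto
  then show thesis
    using that[of 1 1] that[of 1 "-1"] that[of "-1" 1] that[of "-1" "-1"]
    unfolding payoff_max xt fst_conv snd_conv le_max_iff_disj abs_minus_cancel abs_one
    by blast
qed

lemma game_points_after_move:
  assumes "Z \<in> game_points T \<epsilon>" "snd Z < T"
  shows "(y, snd Z + \<epsilon>\<^sup>2) \<in> game_points T \<epsilon>"
proof -
  obtain k :: nat where k: "snd Z = T - real k * \<epsilon>\<^sup>2" "0 \<le> snd Z"
    using assms(1) unfolding game_points_def case_prod_beta by blast
  with assms(2) obtain j where "k = Suc j"
    by (cases k) auto
  with k(1) have "snd Z + \<epsilon>\<^sup>2 = T - real j * \<epsilon>\<^sup>2"
    by (simp add: algebra_simps)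
  moreover have "0 \<le> snd Z + \<epsilon>\<^sup>2"
    using k(2) by simp
  ultimately show ?thesis
    unfolding game_points_def by blast
qed

theorem lemma3p2:
  fixes \<gamma> T \<alpha>1 \<alpha>2 :: real and \<Omega> :: "(real^2) set" and u0 :: "real^2 \<Rightarrow> real"
  assumes "1/3 < \<gamma>" and "\<gamma> < 1" and "T > 0"
    and "smooth_domain \<Omega>" and "bounded \<Omega>"
    and "\<exists>L. L-lipschitz_on UNIV u0"
    and "\<And>x. x \<in> \<Omega> \<Longrightarrow> u0 x < 0"
    and "\<And>x. x \<in> UNIV - closure \<Omega> \<Longrightarrow> u0 x \<ge> 0"
    and "\<And>x. \<bar>u0 x\<bar> \<le> 1"
    and "(1 - \<gamma>) / (2 * \<gamma>) < \<alpha>1" and "\<alpha>1 < min 1 ((1 - \<gamma>) / \<gamma>)"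
    and "0 < \<alpha>2" and "\<alpha>2 < min (\<alpha>1 * (2 * \<gamma> / (1 - \<gamma>)) - 1) (1/3)"
  shows "viscosity_subsolution \<gamma> T (u_bar \<gamma> \<alpha>1 \<alpha>2 T u0)"
proof -
  define S where "S = (UNIV \<times> {0<..<T} :: ((real^2) \<times> real) set)"
  have openS: "open S"
    unfolding S_def by (intro open_Times) auto
  define u where "u = u_bar \<gamma> \<alpha>1 \<alpha>2 T u0"
  let ?w = "value_fn \<gamma> \<alpha>1 \<alpha>2 T u0"
  have \<gamma>: "0 < \<gamma>" "\<gamma> < 1"
    using assms(1,2) by simp_all
  have "0 < (1 - \<gamma>) / (2 * \<gamma>)"
    using \<gamma> by simp
  then have \<alpha>: "0 < \<alpha>1" "0 < \<alpha>2"
    using assms(10,12) by linarith+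
  obtain L where L: "L-lipschitz_on UNIV u0"
    using assms(6) by blast
  have lim: "upper_half_relaxed_limit (game_points T) ?w Y = ereal (u Y)" if "Y \<in> S" for Y
  proof -
    obtain x t where Y: "Y = (x, t)" "0 \<le> t" "t \<le> T"
      using \<open>Y \<in> S\<close> unfolding S_def by force
    have "\<bar>upper_half_relaxed_limit (game_points T) ?w Y\<bar> \<le> 1"
      unfolding Y(1) by (rule upper_limit_finite[OF \<alpha> assms(9) Y(2,3)])
    then show ?thesis
      unfolding u_def u_bar_def
      by (cases "upper_half_relaxed_limit (game_points T) ?w Y") (auto simp: one_ereal_def)
  qed
  have usc: "upper_semicontinuous_on S u"
    by (rule upper_semicontinuous_upper_half_relaxed_limit[OF lim])
  have "if grad (\<lambda>x. \<phi> (x, t0)) x0 \<noteq> 0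
      then 0 \<le> deriv (\<lambda>t. \<phi> (x0, t)) t0 - norm (grad (\<lambda>x. \<phi> (x, t0)) x0) * varphi \<gamma> (curv (\<lambda>x. \<phi> (x, t0)) x0)
      else 0 \<le> deriv (\<lambda>t. \<phi> (x0, t)) t0"
    if smooth: "smooth_on \<phi> S" and t0: "t0 \<in> {0<..<T}"
      and loc_max: "\<forall>\<^sub>F Y in nhds (x0, t0). u Y - \<phi> Y \<le> u (x0, t0) - \<phi> (x0, t0)" for \<phi> x0 t0
  proof (rule ccontr)
    assume not_sub: "\<not> ?thesis"
    define X where "X = (x0, t0)"
    have XS: "X \<in> S"
      using t0 by (simp add: X_def S_def)
    obtain g \<tau> H where jet: "jet_on \<phi> g \<tau> H S"
      using smooth_imp_jet[OF smooth openS] .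
    have d\<phi>: "(\<phi> has_derivative (\<lambda>(p, r). p \<bullet> g Y + r * \<tau> Y)) (at Y)" if "Y \<in> S" for Y
      using jet that unfolding jet_on_def by blast
    have gderiv: "GDERIV (\<lambda>x. \<phi> (x, t0)) y :> g (y, t0)" for y
      unfolding gderiv_def
      using has_derivative_compose[of "\<lambda>x. (x, t0)" "\<lambda>p. (p, 0)" y UNIV \<phi>,
          OF has_derivative_Pair[OF has_derivative_ident has_derivative_const] d\<phi>[of "(y, t0)"]] t0
      by (simp add: S_def)
    have dg: "((\<lambda>y. g (y, t0)) has_derivative (*v) (H X)) (at x0)"
      using jet XS unfolding jet_on_def X_def by fastforce
    have "((\<lambda>t. \<phi> (x0, t)) has_derivative (\<lambda>r. r * \<tau> X)) (at t0)"
      using has_derivative_compose[of "\<lambda>t. (x0, t)" "\<lambda>r. (0, r)" t0 UNIV \<phi>,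
          OF has_derivative_Pair[OF has_derivative_const has_derivative_ident] d\<phi>[of "(x0, t0)"]] XS
      by (simp add: X_def)
    then have dt: "deriv (\<lambda>t. \<phi> (x0, t)) t0 = \<tau> X"
      by (intro DERIV_imp_deriv) (simp add: has_field_derivative_def mult_commute_abs)
    have "if g (x0, t0) \<noteq> 0 then \<tau> X - norm (g (x0, t0)) * varphi \<gamma> (curv (\<lambda>x. \<phi> (x, t0)) x0) < 0 else \<tau> X < 0"
      using not_sub unfolding dt grad_eqI[OF gderiv] by (auto split: if_splits)
    from step_size_with_negative_drift[OF \<gamma> gderiv dg this] obtain s m where s: "0 < s" and m: "m < 0"
      and neg: "\<And>w. norm w = 1 \<Longrightarrow> w \<bullet> g X = 0 \<Longrightarrow>
        s\<^sup>2 / 2 * (w \<bullet> (H X *v w)) + f_gam \<gamma> s * norm (g X) + \<tau> X \<le> m"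
      unfolding X_def by blast
    (* The quadratic penalty makes the maximum at X strict. It keeps the first derivatives at X and
       adds 2 d times the identity to the Hessian; with this d the drift is still at most m / 2. *)
    define d where "d = - m / (2 * s\<^sup>2)"
    have d: "0 < d" "s\<^sup>2 * d = - m / 2"
      using s m by (simp_all add: d_def divide_neg_pos)
    define \<psi> where "\<psi> Y = \<phi> Y + d * (dist Y X)\<^sup>2" for Y
    define g' where "g' Y = g Y + (2 * d) *\<^sub>R (fst Y - fst X)" for Y
    have jet': "jet_on \<psi> g' (\<lambda>Y. \<tau> Y + 2 * d * (snd Y - snd X)) (\<lambda>Y. H Y + (2 * d) *\<^sub>R mat 1) S"
      unfolding \<psi>_def[abs_def] g'_def[abs_def] by (rule jet_on_add_square_distance[OF jet])
    obtain r1 where r1: "0 < r1" "\<And>Y. dist Y X < r1 \<Longrightarrow> u Y - \<phi> Y \<le> u X - \<phi> X"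
      using loc_max unfolding X_def eventually_nhds_metric by blast
    obtain r2 where r2: "0 < r2" "cball X r2 \<subseteq> S"
      using openS XS open_contains_cball by blast
    define K where "K = cball X (min r2 (r1 / 2))"
    have K: "compact K" "X \<in> interior K" "K \<subseteq> S"
      using r1(1) r2 unfolding K_def interior_cball by auto
    have cont: "continuous_on S \<phi>"
      using d\<phi> openS by (auto simp: continuous_on_eq_continuous_at intro: has_derivative_continuous)
    have "continuous_on K \<psi>"
      unfolding \<psi>_def by (intro continuous_intros continuous_on_subset[OF cont K(3)])
    moreover have "Y = X" if "Y \<in> K" "u X - \<psi> X \<le> u Y - \<psi> Y" for Y
    proof -
      have "u Y - \<phi> Y \<le> u X - \<phi> X"
        using that(1) r1 by (intro r1(2)) (auto simp: K_def dist_commute)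
      with that(2) have "d * (dist Y X)\<^sup>2 \<le> 0"
        by (simp add: \<psi>_def)
      with d(1) show ?thesis
        by (simp add: mult_le_0_iff)
    qed
    moreover have "?w \<epsilon> Y \<le> 1" if "0 < \<epsilon>" "\<epsilon> < 1" for \<epsilon> Y
      using value_fn_bounds[OF that \<alpha> assms(9)] by (simp add: abs_le_iff)
    ultimately obtain Z0 e0 where Z0: "Z0 \<longlonglongrightarrow> X" "e0 \<longlonglongrightarrow> 0" "\<And>n. 0 < e0 n" "\<And>n. e0 n < 1"
      "\<And>n. Z0 n \<in> K" "\<And>n. Z0 n \<in> game_points T (e0 n)"
      "\<And>n Z'. Z' \<in> K \<Longrightarrow> Z' \<in> game_points T (e0 n) \<Longrightarrow>
        ?w (e0 n) Z' - \<psi> Z' \<le> ?w (e0 n) (Z0 n) - \<psi> (Z0 n) + e0 n ^ 3"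
      using near_maximizers_tendsto[of K X \<psi> "game_points T" ?w u 1] K lim by blast
    (* Directions tangential to the level line of the penalized function at the near-maximizer
       itself, not at X: the first-order term has to vanish exactly. *)
    have "\<forall>n. \<exists>v. norm v = 1 \<and> v \<bullet> g' (Z0 n) = 0"
      by (intro allI ex_unit_tangent)
    then obtain v0 where v0: "\<And>n. norm (v0 n) = 1" "\<And>n. v0 n \<bullet> g' (Z0 n) = 0"
      by metis
    have "seq_compact (sphere (0::real^2) 1)"
      by (simp add: compact_imp_seq_compact)
    then obtain w \<sigma> where \<sigma>: "strict_mono \<sigma>" "(v0 \<circ> \<sigma>) \<longlonglongrightarrow> w"
      using v0(1) by (elim seq_compactE[of _ v0]) auto
    define e where "e = e0 \<circ> \<sigma>"
    define Z where "Z = Z0 \<circ> \<sigma>"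
    define v where "v = v0 \<circ> \<sigma>"
    have e: "e \<longlonglongrightarrow> 0" "\<And>n. 0 < e n" "\<And>n. e n < 1"
      unfolding e_def using LIMSEQ_subseq_LIMSEQ[OF Z0(2) \<sigma>(1)] Z0(3,4) by auto
    have "snd Y < T" if "Y \<in> K" for Y
      using that K(3) by (cases Y) (auto simp: S_def)
    then have Z: "Z \<longlonglongrightarrow> X" "\<And>n. Z n \<in> game_points T (e n)" "\<And>n. snd (Z n) < T"
      unfolding Z_def e_def using LIMSEQ_subseq_LIMSEQ[OF Z0(1) \<sigma>(1)] Z0(5,6) by auto
    have v: "\<And>n. norm (v n) = 1" "\<And>n. v n \<bullet> g' (Z n) = 0" "v \<longlonglongrightarrow> w"
      unfolding v_def Z_def using v0 \<sigma> by auto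
    let ?move = "\<lambda>n b \<beta>. (fst (Z n) + (b * e n * s) *\<^sub>R v n + (\<beta> * (e n)\<^sup>2 * f_gam \<gamma> s) *\<^sub>R perp (v n),
      snd (Z n) + (e n)\<^sup>2)"
    have "\<exists>b \<beta>. \<bar>b\<bar> = 1 \<and> \<bar>\<beta>\<bar> = 1 \<and> (s \<in> step_range \<alpha>1 \<alpha>2 (e n) \<longrightarrow> ?w (e n) (Z n) \<le> ?w (e n) (?move n b \<beta>))" for n
    proof (cases "s \<in> step_range \<alpha>1 \<alpha>2 (e n)")
      case True
      from value_fn_le_after_move[OF e(2,3) \<alpha> L Z(2,3) v(1) True] show ?thesis
        by blast
    qed (auto intro!: exI[of _ 1])
    then obtain b \<beta> where b: "\<And>n. \<bar>b n\<bar> = 1" and \<beta>: "\<And>n. \<bar>\<beta> n\<bar> = 1"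
      and better: "\<And>n. s \<in> step_range \<alpha>1 \<alpha>2 (e n) \<Longrightarrow> ?w (e n) (Z n) \<le> ?w (e n) (?move n (b n) (\<beta> n))"
      by metis
    have F: "0 \<le> f_gam \<gamma> s"
      by (rule f_gam_nonneg[OF \<gamma>])
    have "(\<lambda>n. ?move n (b n) (\<beta> n)) \<longlonglongrightarrow> (fst X + 0 + 0, snd X + 0\<^sup>2)"
    proof (intro tendsto_intros Z(1) e(1))
      have "norm ((b n * e n * s) *\<^sub>R v n) = e n * s" for n
        using less_imp_le[OF e(2)] s by (simp add: abs_mult b v(1))
      then show "(\<lambda>n. (b n * e n * s) *\<^sub>R v n) \<longlonglongrightarrow> 0"
        by - (rule tendsto_norm_zero_cancel, simp only: tendsto_mult_left_zero[OF e(1)])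
      have "norm ((\<beta> n * (e n)\<^sup>2 * f_gam \<gamma> s) *\<^sub>R perp (v n)) = (e n)\<^sup>2 * f_gam \<gamma> s" for n
        using F by (simp add: abs_mult \<beta> v(1) norm_perp)
      moreover have "(\<lambda>n. (e n)\<^sup>2 * f_gam \<gamma> s) \<longlonglongrightarrow> 0"
        using e(1) by (auto intro!: tendsto_eq_intros)
      ultimately show "(\<lambda>n. (\<beta> n * (e n)\<^sup>2 * f_gam \<gamma> s) *\<^sub>R perp (v n)) \<longlonglongrightarrow> 0"
        by - (rule tendsto_norm_zero_cancel, simp only:)
    qed
    then have "(\<lambda>n. ?move n (b n) (\<beta> n)) \<longlonglongrightarrow> X"
      by simp
    then have "\<forall>\<^sub>F n in sequentially. ?move n (b n) (\<beta> n) \<in> interior K"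
      by (rule topological_tendstoD) (use K in auto)
    with step_range_eventually[OF s \<alpha> e(1,2)]
    have "\<forall>\<^sub>F n in sequentially. \<psi> (Z n) - e n ^ 3 \<le> \<psi> (?move n (b n) (\<beta> n))"
    proof eventually_elim
      case (elim n)
      have "?move n (b n) (\<beta> n) \<in> game_points T (e n)"
        by (rule game_points_after_move[OF Z(2,3)])
      moreover have "?move n (b n) (\<beta> n) \<in> K"
        using elim(2) interior_subset by blast
      ultimately have "?w (e n) (?move n (b n) (\<beta> n)) - \<psi> (?move n (b n) (\<beta> n))
          \<le> ?w (e n) (Z n) - \<psi> (Z n) + e n ^ 3"
        using Z0(7)[of "?move n (b n) (\<beta> n)" "\<sigma> n"] by (simp add: e_def Z_def)
      with better[OF elim(1)] show ?case
        by linarith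
    qed
    from move_limit[OF jet'[unfolded S_def] _ Z(1) e(1,2) s F v b \<beta> this]
    have "0 \<le> s\<^sup>2 / 2 * (w \<bullet> ((H X + (2 * d) *\<^sub>R mat 1) *v w)) + f_gam \<gamma> s * norm (g X) + \<tau> X"
      using t0 by (simp add: g'_def X_def)
    moreover have w: "norm w = 1"
      using tendsto_norm[OF v(3)] v(1) by (simp add: LIMSEQ_const_iff)
    then have "w \<bullet> ((H X + (2 * d) *\<^sub>R mat 1) *v w) = w \<bullet> (H X *v w) + 2 * d"
      by (simp add: matrix_vector_mult_add_rdistrib scaleR_matrix_vector_assoc[symmetric] inner_add_right
          norm_eq_1)
    moreover have "w \<bullet> g X = 0"
    proof -
      have "isCont g' X"
        using jet' XS openS unfolding jet_on_def by (simp add: continuous_on_eq_continuous_at)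
      then have "(\<lambda>n. v n \<bullet> g' (Z n)) \<longlonglongrightarrow> w \<bullet> g' X"
        by (intro tendsto_inner v(3) isCont_tendsto_compose[OF _ Z(1)])
      then have "w \<bullet> g' X = 0"
        by (simp add: v(2) LIMSEQ_const_iff)
      then show ?thesis
        by (simp add: g'_def)
    qed
    ultimately have "0 \<le> m + s\<^sup>2 * d"
      using neg[OF w] by (simp add: algebra_simps)
    with d(2) m show False
      by simp
  qed
  with usc show ?thesis
    unfolding viscosity_subsolution_def u_def S_def Let_def by blast
qed

end
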